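(* Let $(R,\mathfrak m)$ be a Noetherian local ring of prime characteristic $p>0$. Then for every finitely generated $R$-module $M$, the operation $N\mapsto N^{F\mathrm{sp}}_M$ on submodules of $M$ is a special part of Frobenius closure $N\mapsto N^F_M$ for $M$. That is, for all submodules $L,N\subseteq M$: (1) $L^{F\mathrm{sp}}_M$ is a submodule of $M$; (2) $\mathfrak m L\subseteq L^{F\mathrm{sp}}_M\subseteq L^F_M$; (3) $(L^F_M)^{F\mathrm{sp}}_M=L^{F\mathrm{sp}}_M=(L^{F\mathrm{sp}}_M)^F_M$; (4) if $L\subseteq N\subseteq (L+N^{F\mathrm{sp}}_M)^F_M$, then $N\subseteq L^F_M$.
   Context: For $e\ge 0$ and $q=p^e$, let $F^e(M)$ denote the base change of $M$ along the $e$-th iterate of the Frobenius endomorphism of $R$. For $z\in M$ let $z^q:=1\otimes z\in F^e(M)$. For a submodule $N\subseteq M$, let $N^{[q]}_M$ be the $R$-submodule of $F^e(M)$ generated by $\{z^q : z\in N\}$ (the image of $F^e(N)\to F^e(M)$). The Frobenius closure is $N^F_M=\{z\in M : z^q\in N^{[q]}_M \text{ for some } q=p^e\}$. The special part of the Frobenius closure is $N^{F\mathrm{sp}}_M=\{z\in M : \exists\, q=p^e \text{ (}e\ge 0\text{) with } z^q\in \mathfrak m N^{[q]}_M\}$. *)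

theory Defs
  imports "HOL-Computational_Algebra.Primes" "HOL-Algebra.Ring_Divisibility" "HOL-Algebra.Module"
begin

section \<open>Rings and modules\<close>

locale local_ring = cring R + maximalideal \<mm> R for \<mm> and R (structure) +
  assumes unique_maximalideal: "\<And>J. maximalideal J R \<Longrightarrow> J = \<mm>"

text \<open>The additive order of \<open>1\<close>; by the convention of \<^const>\<open>group.ord\<close>
  it is \<open>0\<close> when no positive multiple of \<open>1\<close> vanishes.\<close>

definition ring_char :: "('a, 'c) ring_scheme \<Rightarrow> nat"
  where "ring_char R = group.ord (add_monoid R) \<one>\<^bsub>R\<^esub>"

definition generated_submodule ::
  "('a, 'c) ring_scheme \<Rightarrow> ('a, 'b, 'd) module_scheme \<Rightarrow> 'b set \<Rightarrow> 'b set"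
  where "generated_submodule R M S = \<Inter> {H. submodule H R M \<and> S \<subseteq> H}"

definition finitely_generated_module ::
  "('a, 'c) ring_scheme \<Rightarrow> ('a, 'b, 'd) module_scheme \<Rightarrow> bool"
  where "finitely_generated_module R M \<longleftrightarrow>
    (\<exists>S. finite S \<and> S \<subseteq> carrier M \<and> generated_submodule R M S = carrier M)"

definition ideal_smult ::
  "('a, 'c) ring_scheme \<Rightarrow> ('a, 'b, 'd) module_scheme \<Rightarrow> 'a set \<Rightarrow> 'b set \<Rightarrow> 'b set"
  where "ideal_smult R M I N =
    generated_submodule R M {a \<odot>\<^bsub>M\<^esub> x |a x. a \<in> I \<and> x \<in> N}"


section \<open>Base change\<close>

text \<open>Modules are records extending rings; the fields \<open>mult\<close> and \<open>one\<close> play no role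
  in the module structure and are left undefined below.\<close>

definition free_module :: "('a, 'c) ring_scheme \<Rightarrow> 'b set \<Rightarrow> ('a, 'b \<Rightarrow> 'a) module"
  where "free_module R A =
    \<lparr>carrier = {f. range f \<subseteq> carrier R \<and> finite {x. f x \<noteq> \<zero>\<^bsub>R\<^esub>} \<and> {x. f x \<noteq> \<zero>\<^bsub>R\<^esub>} \<subseteq> A},
     mult = undefined, one = undefined,
     zero = (\<lambda>x. \<zero>\<^bsub>R\<^esub>), add = (\<lambda>f g x. f x \<oplus>\<^bsub>R\<^esub> g x),
     smult = (\<lambda>a f x. a \<otimes>\<^bsub>R\<^esub> f x)\<rparr>"

definition free_gen :: "('a, 'c) ring_scheme \<Rightarrow> 'b \<Rightarrow> 'b \<Rightarrow> 'a"
  where "free_gen R x = (\<lambda>y. if y = x then \<one>\<^bsub>R\<^esub> else \<zero>\<^bsub>R\<^esub>)"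

definition quotient_module :: "('a, 'b, 'd) module_scheme \<Rightarrow> 'b set \<Rightarrow> ('a, 'b set) module"
  where "quotient_module M N =
    \<lparr>carrier = a_rcosets\<^bsub>M\<^esub> N,
     mult = undefined, one = undefined,
     zero = N, add = set_add M,
     smult = (\<lambda>a X. \<Union>x\<in>X. N +>\<^bsub>M\<^esub> (a \<odot>\<^bsub>M\<^esub> x))\<rparr>"

text \<open>For a ring homomorphism \<open>\<phi> : R \<rightarrow> S\<close> and an \<open>R\<close>-module \<open>M\<close>, the \<open>S\<close>-module
  \<open>S \<otimes>\<^sub>R M\<close> is presented by generators \<open>1 \<otimes> x\<close> (\<open>x \<in> M\<close>), subject to
  \<open>1 \<otimes> (x + y) = 1 \<otimes> x + 1 \<otimes> y\<close> and \<open>1 \<otimes> (a x) = \<phi>(a) (1 \<otimes> x)\<close>.\<close>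

definition base_change_relations ::
  "('s, 'c) ring_scheme \<Rightarrow> ('a \<Rightarrow> 's) \<Rightarrow> ('a, 'c2) ring_scheme \<Rightarrow> ('a, 'b, 'd) module_scheme
    \<Rightarrow> ('b \<Rightarrow> 's) set"
  where "base_change_relations S \<phi> R M = (let F = free_module S (carrier M) in
    {free_gen S (x \<oplus>\<^bsub>M\<^esub> y) \<ominus>\<^bsub>F\<^esub> (free_gen S x \<oplus>\<^bsub>F\<^esub> free_gen S y)
       |x y. x \<in> carrier M \<and> y \<in> carrier M} \<union>
    {free_gen S (a \<odot>\<^bsub>M\<^esub> x) \<ominus>\<^bsub>F\<^esub> (\<phi> a \<odot>\<^bsub>F\<^esub> free_gen S x)
       |a x. a \<in> carrier R \<and> x \<in> carrier M})"

definition base_change_kernel ::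
  "('s, 'c) ring_scheme \<Rightarrow> ('a \<Rightarrow> 's) \<Rightarrow> ('a, 'c2) ring_scheme \<Rightarrow> ('a, 'b, 'd) module_scheme
    \<Rightarrow> ('b \<Rightarrow> 's) set"
  where "base_change_kernel S \<phi> R M =
    generated_submodule S (free_module S (carrier M)) (base_change_relations S \<phi> R M)"

definition base_change ::
  "('s, 'c) ring_scheme \<Rightarrow> ('a \<Rightarrow> 's) \<Rightarrow> ('a, 'c2) ring_scheme \<Rightarrow> ('a, 'b, 'd) module_scheme
    \<Rightarrow> ('s, ('b \<Rightarrow> 's) set) module"
  where "base_change S \<phi> R M =
    quotient_module (free_module S (carrier M)) (base_change_kernel S \<phi> R M)"

text \<open>The element \<open>1 \<otimes> x\<close>.\<close>

definition base_change_unit ::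
  "('s, 'c) ring_scheme \<Rightarrow> ('a \<Rightarrow> 's) \<Rightarrow> ('a, 'c2) ring_scheme \<Rightarrow> ('a, 'b, 'd) module_scheme
    \<Rightarrow> 'b \<Rightarrow> ('b \<Rightarrow> 's) set"
  where "base_change_unit S \<phi> R M x =
    base_change_kernel S \<phi> R M +>\<^bsub>free_module S (carrier M)\<^esub> free_gen S x"


subsection \<open>Adequacy of the construction\<close>

lemma (in module) generated_submodule_is_submodule:
  assumes "S \<subseteq> carrier M"
  shows "submodule (generated_submodule R M S) R M"
proof (rule submoduleI)
  show "generated_submodule R M S \<subseteq> carrier M"
    unfolding generated_submodule_def using carrier_is_submodule assms by blast
qed (auto simp: generated_submodule_def dest: submoduleE subgroup.one_closed[OF submodule.axioms(1)])

lemma free_module_is_module: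
  assumes "cring S"
  shows "Module.module S (free_module S A)"
proof -
  interpret cring S by fact
  show ?thesis
  proof (rule moduleI)
    show "abelian_group (free_module S A)"
    proof (rule abelian_groupI)
      fix x assume x: "x \<in> carrier (free_module S A)"
      show "\<exists>y\<in>carrier (free_module S A). y \<oplus>\<^bsub>free_module S A\<^esub> x = \<zero>\<^bsub>free_module S A\<^esub>"
      proof (rule bexI)
        show "(\<lambda>y. \<ominus>\<^bsub>S\<^esub> x y) \<oplus>\<^bsub>free_module S A\<^esub> x = \<zero>\<^bsub>free_module S A\<^esub>"
          using x by (auto simp: free_module_def image_subset_iff l_neg)
        have "{y. \<ominus>\<^bsub>S\<^esub> x y \<noteq> \<zero>\<^bsub>S\<^esub>} \<subseteq> {y. x y \<noteq> \<zero>\<^bsub>S\<^esub>}" by auto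
        then show "(\<lambda>y. \<ominus>\<^bsub>S\<^esub> x y) \<in> carrier (free_module S A)"
          using x by (auto simp: free_module_def image_subset_iff intro: finite_subset)
      qed
    next
      fix x y assume xy: "x \<in> carrier (free_module S A)" "y \<in> carrier (free_module S A)"
      have "{z. x z \<oplus>\<^bsub>S\<^esub> y z \<noteq> \<zero>\<^bsub>S\<^esub>} \<subseteq> {z. x z \<noteq> \<zero>\<^bsub>S\<^esub>} \<union> {z. y z \<noteq> \<zero>\<^bsub>S\<^esub>}" by auto
      moreover have "finite ({z. x z \<noteq> \<zero>\<^bsub>S\<^esub>} \<union> {z. y z \<noteq> \<zero>\<^bsub>S\<^esub>})"
        "{z. x z \<noteq> \<zero>\<^bsub>S\<^esub>} \<union> {z. y z \<noteq> \<zero>\<^bsub>S\<^esub>} \<subseteq> A"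
        using xy by (auto simp: free_module_def)
      ultimately have "finite {z. x z \<oplus>\<^bsub>S\<^esub> y z \<noteq> \<zero>\<^bsub>S\<^esub>}" "{z. x z \<oplus>\<^bsub>S\<^esub> y z \<noteq> \<zero>\<^bsub>S\<^esub>} \<subseteq> A"
        by (meson finite_subset subset_trans)+
      then show "x \<oplus>\<^bsub>free_module S A\<^esub> y \<in> carrier (free_module S A)"
        using xy by (simp add: free_module_def image_subset_iff)
    next
      show "\<zero>\<^bsub>free_module S A\<^esub> \<in> carrier (free_module S A)" by (auto simp: free_module_def)
    qed (auto simp: free_module_def image_subset_iff a_ac)
  next
    fix a x assume "a \<in> carrier S" "x \<in> carrier (free_module S A)"
    moreover then have "{y. a \<otimes>\<^bsub>S\<^esub> x y \<noteq> \<zero>\<^bsub>S\<^esub>} \<subseteq> {y. x y \<noteq> \<zero>\<^bsub>S\<^esub>}" by auto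
    ultimately show "a \<odot>\<^bsub>free_module S A\<^esub> x \<in> carrier (free_module S A)"
      by (auto simp: free_module_def image_subset_iff intro: finite_subset)
  qed (auto simp: free_module_def image_subset_iff l_distr r_distr m_assoc assms)
qed

lemma quotient_module_is_module:
  assumes "Module.module R M" "submodule N R M"
  shows "Module.module R (quotient_module M N)"
    and "\<And>x y. x \<in> carrier M \<Longrightarrow> y \<in> carrier M \<Longrightarrow>
      (N +>\<^bsub>M\<^esub> x) \<oplus>\<^bsub>quotient_module M N\<^esub> (N +>\<^bsub>M\<^esub> y) = N +>\<^bsub>M\<^esub> (x \<oplus>\<^bsub>M\<^esub> y)"
    and "\<And>a x. a \<in> carrier R \<Longrightarrow> x \<in> carrier M \<Longrightarrow>
      a \<odot>\<^bsub>quotient_module M N\<^esub> (N +>\<^bsub>M\<^esub> x) = N +>\<^bsub>M\<^esub> (a \<odot>\<^bsub>M\<^esub> x)"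
proof -
  interpret M: Module.module R M by fact
  interpret N: submodule N R M by fact
  have nrm: "N \<lhd> add_monoid M"
    using N.subgroup_axioms M.add.normal_iff_subgroup  M.a_comm_group comm_group.normal_iff_subgroup by blast
  note sub = M.submoduleE[OF assms(2)]
  have sum: "(N +>\<^bsub>M\<^esub> x) <+>\<^bsub>M\<^esub> (N +>\<^bsub>M\<^esub> y) = N +>\<^bsub>M\<^esub> (x \<oplus>\<^bsub>M\<^esub> y)"
    if "x \<in> carrier M" "y \<in> carrier M" for x y
    using normal.rcos_sum[OF nrm, of x y] that by (simp add: a_r_coset_def set_add_def)
  have eqc: "N +>\<^bsub>M\<^esub> x = N +>\<^bsub>M\<^esub> y" if "x \<in> N +>\<^bsub>M\<^esub> y" "y \<in> carrier M" for x y
    using M.add.repr_independence[of x N y] that N.subgroup_axioms by (simp add: a_r_coset_def)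
  have smul: "(\<Union>x'\<in>N +>\<^bsub>M\<^esub> x. N +>\<^bsub>M\<^esub> (a \<odot>\<^bsub>M\<^esub> x')) = N +>\<^bsub>M\<^esub> (a \<odot>\<^bsub>M\<^esub> x)"
    if a: "a \<in> carrier R" and x: "x \<in> carrier M" for a x
  proof -
    have "N +>\<^bsub>M\<^esub> (a \<odot>\<^bsub>M\<^esub> x') = N +>\<^bsub>M\<^esub> (a \<odot>\<^bsub>M\<^esub> x)" if x': "x' \<in> N +>\<^bsub>M\<^esub> x" for x'
    proof (rule eqc)
      obtain n where n: "n \<in> N" "x' = n \<oplus>\<^bsub>M\<^esub> x" using x' by (auto simp: a_r_coset_def')
      then have "a \<odot>\<^bsub>M\<^esub> x' = a \<odot>\<^bsub>M\<^esub> n \<oplus>\<^bsub>M\<^esub> a \<odot>\<^bsub>M\<^esub> x"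
        using M.smult_r_distr[OF a subsetD[OF sub(1) n(1)] x] by simp
      then show "a \<odot>\<^bsub>M\<^esub> x' \<in> N +>\<^bsub>M\<^esub> (a \<odot>\<^bsub>M\<^esub> x)" using n a by (auto simp: a_r_coset_def')
    qed (use a x in auto)
    moreover have "x \<in> N +>\<^bsub>M\<^esub> x"
      using x M.l_zero[of x] N.one_closed by (force simp: a_r_coset_def')
    ultimately show ?thesis by blast
  qed
  have carr: "carrier (quotient_module M N) = (\<lambda>x. N +>\<^bsub>M\<^esub> x) ` carrier M"
    by (auto simp: quotient_module_def A_RCOSETS_def')
  have zero: "N = N +>\<^bsub>M\<^esub> \<zero>\<^bsub>M\<^esub>"
    using M.add.coset_mult_one sub(1) by simp
  show add: "\<And>x y. x \<in> carrier M \<Longrightarrow> y \<in> carrier M \<Longrightarrow>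
      (N +>\<^bsub>M\<^esub> x) \<oplus>\<^bsub>quotient_module M N\<^esub> (N +>\<^bsub>M\<^esub> y) = N +>\<^bsub>M\<^esub> (x \<oplus>\<^bsub>M\<^esub> y)"
    by (simp add: quotient_module_def sum)
  show smult: "\<And>a x. a \<in> carrier R \<Longrightarrow> x \<in> carrier M \<Longrightarrow>
      a \<odot>\<^bsub>quotient_module M N\<^esub> (N +>\<^bsub>M\<^esub> x) = N +>\<^bsub>M\<^esub> (a \<odot>\<^bsub>M\<^esub> x)"
    by (simp add: quotient_module_def smul)
  have z: "\<zero>\<^bsub>quotient_module M N\<^esub> = N +>\<^bsub>M\<^esub> \<zero>\<^bsub>M\<^esub>"
    using zero by (simp add: quotient_module_def)
  show "Module.module R (quotient_module M N)"
  proof (rule moduleI)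
    show "abelian_group (quotient_module M N)"
    proof (rule abelian_groupI)
      fix x assume "x \<in> carrier (quotient_module M N)"
      then obtain u where u: "u \<in> carrier M" "x = N +>\<^bsub>M\<^esub> u" by (auto simp: carr)
      then show "\<exists>y\<in>carrier (quotient_module M N). y \<oplus>\<^bsub>quotient_module M N\<^esub> x = \<zero>\<^bsub>quotient_module M N\<^esub>"
        by (intro bexI[of _ "N +>\<^bsub>M\<^esub> (\<ominus>\<^bsub>M\<^esub> u)"]) (auto simp: carr add z M.l_neg)
    qed (auto simp: carr z add M.a_ac)
  qed (auto simp: carr add smult M.smult_l_distr M.smult_r_distr M.smult_assoc1 M.R.is_cring)
qed

lemma free_module_induct [consumes 2, case_names zero gen add]:
  assumes "cring S" and f: "f \<in> carrier (free_module S A)"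
    and "P (\<lambda>x. \<zero>\<^bsub>S\<^esub>)"
    and "\<And>a x. a \<in> carrier S \<Longrightarrow> x \<in> A \<Longrightarrow> P (a \<odot>\<^bsub>free_module S A\<^esub> free_gen S x)"
    and "\<And>f g. f \<in> carrier (free_module S A) \<Longrightarrow> g \<in> carrier (free_module S A) \<Longrightarrow> P f \<Longrightarrow> P g
      \<Longrightarrow> P (f \<oplus>\<^bsub>free_module S A\<^esub> g)"
  shows "P f"
proof -
  interpret cring S by fact
  have "finite B \<Longrightarrow> f \<in> carrier (free_module S A) \<Longrightarrow> {x. f x \<noteq> \<zero>\<^bsub>S\<^esub>} \<subseteq> B \<Longrightarrow> P f" for B
  proof (induction B arbitrary: f rule: finite_induct)
    case empty
    then have "f = (\<lambda>x. \<zero>\<^bsub>S\<^esub>)" by auto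
    then show ?case using assms(3) by simp
  next
    case (insert b B)
    let ?g = "f(b := \<zero>\<^bsub>S\<^esub>)" and ?h = "f b \<odot>\<^bsub>free_module S A\<^esub> free_gen S b"
    have r: "\<And>x. f x \<in> carrier S" using insert.prems by (auto simp: free_module_def)
    have "{x. ?g x \<noteq> \<zero>\<^bsub>S\<^esub>} \<subseteq> {x. f x \<noteq> \<zero>\<^bsub>S\<^esub>}" by auto
    then have g: "?g \<in> carrier (free_module S A)"
      using insert.prems r by (auto simp: free_module_def intro: finite_subset)
    then have Pg: "P ?g" by (rule insert.IH) (use insert.prems in auto)
    show ?case
    proof (cases "f b = \<zero>\<^bsub>S\<^esub>")
      case True
      then show ?thesis using Pg by (metis fun_upd_triv)
    next
      case False
      then have b: "b \<in> A" using insert.prems by (auto simp: free_module_def)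
      have h: "?h \<in> carrier (free_module S A)"
        using b r by (auto simp: free_module_def free_gen_def)
      have "f = ?g \<oplus>\<^bsub>free_module S A\<^esub> ?h"
        using r by (auto simp: free_module_def free_gen_def)
      then show ?thesis using assms(5)[OF g h Pg assms(4)[OF r b]] by simp
    qed
  qed
  with f show ?thesis by (auto simp: free_module_def)
qed

lemma free_gen_carrier:
  assumes "cring S" "x \<in> A"
  shows "free_gen S x \<in> carrier (free_module S A)"
proof -
  interpret cring S by fact
  show ?thesis using assms by (auto simp: free_module_def free_gen_def)
qed

lemma base_change_relations_carrier:
  assumes "Module.module R M" "cring S" "\<phi> \<in> ring_hom R S"
  shows "base_change_relations S \<phi> R M \<subseteq> carrier (free_module S (carrier M))"
proof -
  interpret M: Module.module R M by fact
  interpret F: Module.module S "free_module S (carrier M)"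
    using free_module_is_module assms(2) by blast
  note [simp] = free_gen_carrier[OF assms(2)] ring_hom_closed[OF assms(3)]
  show ?thesis unfolding base_change_relations_def Let_def by auto
qed

theorem base_change_is_module:
  assumes "Module.module R M" "cring S" "\<phi> \<in> ring_hom R S"
  shows "Module.module S (base_change S \<phi> R M)"
  unfolding base_change_def base_change_kernel_def
  by (rule quotient_module_is_module(1)[OF free_module_is_module[OF assms(2)]
        module.generated_submodule_is_submodule[OF free_module_is_module[OF assms(2)]
          base_change_relations_carrier[OF assms]]])

text \<open>The universal property characterizing \<open>S \<otimes>\<^sub>R M\<close>: every \<open>\<phi>\<close>-semilinear map from \<open>M\<close>
  to an \<open>S\<close>-module factors uniquely through \<open>x \<mapsto> 1 \<otimes> x\<close>.\<close>

theorem base_change_universal: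
  assumes M: "Module.module R M" and S: "cring S" and \<phi>: "\<phi> \<in> ring_hom R S"
    and P: "Module.module S P" and g: "g \<in> carrier M \<rightarrow> carrier P"
    and g_add: "\<And>x y. x \<in> carrier M \<Longrightarrow> y \<in> carrier M \<Longrightarrow> g (x \<oplus>\<^bsub>M\<^esub> y) = g x \<oplus>\<^bsub>P\<^esub> g y"
    and g_smult: "\<And>a x. a \<in> carrier R \<Longrightarrow> x \<in> carrier M \<Longrightarrow> g (a \<odot>\<^bsub>M\<^esub> x) = \<phi> a \<odot>\<^bsub>P\<^esub> g x"
  defines "B \<equiv> base_change S \<phi> R M"
  shows "\<exists>!h. h \<in> carrier B \<rightarrow>\<^sub>E carrier P \<and>
    (\<forall>X\<in>carrier B. \<forall>Y\<in>carrier B. h (X \<oplus>\<^bsub>B\<^esub> Y) = h X \<oplus>\<^bsub>P\<^esub> h Y) \<and>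
    (\<forall>s\<in>carrier S. \<forall>X\<in>carrier B. h (s \<odot>\<^bsub>B\<^esub> X) = s \<odot>\<^bsub>P\<^esub> h X) \<and>
    (\<forall>x\<in>carrier M. h (base_change_unit S \<phi> R M x) = g x)"
proof -
  interpret M: Module.module R M by fact
  interpret P: Module.module S P by fact
  let ?F = "free_module S (carrier M)"
  let ?K = "base_change_kernel S \<phi> R M"
  interpret F: Module.module S ?F
    using free_module_is_module S by blast
  have Ksub: "submodule ?K S ?F" unfolding base_change_kernel_def
    by (intro F.generated_submodule_is_submodule base_change_relations_carrier assms)
  note gen[simp] = free_gen_carrier[OF S]
  note [simp] = ring_hom_closed[OF \<phi>]
  have gc[simp]: "\<And>x. x \<in> carrier M \<Longrightarrow> g x \<in> carrier P" using g by auto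
  define H where "H f = (\<Oplus>\<^bsub>P\<^esub>x\<in>{x. f x \<noteq> \<zero>\<^bsub>S\<^esub>}. f x \<odot>\<^bsub>P\<^esub> g x)" for f
  have Fc: "f x \<in> carrier S" "f x \<noteq> \<zero>\<^bsub>S\<^esub> \<Longrightarrow> x \<in> carrier M" "finite {x. f x \<noteq> \<zero>\<^bsub>S\<^esub>}"
    if "f \<in> carrier ?F" for f x using that by (auto simp: free_module_def)
  have H_eq: "H f = (\<Oplus>\<^bsub>P\<^esub>x\<in>T. f x \<odot>\<^bsub>P\<^esub> g x)"
    if "f \<in> carrier ?F" "finite T" "T \<subseteq> carrier M" "{x. f x \<noteq> \<zero>\<^bsub>S\<^esub>} \<subseteq> T" for f T
    unfolding H_def using that Fc[OF that(1)]
    by (intro P.add.finprod_mono_neutral_cong_left) (auto simp: subset_iff)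
  have H_closed: "H f \<in> carrier P" if "f \<in> carrier ?F" for f
    unfolding H_def by (intro P.finsum_closed) (auto simp: Fc[OF that])
  have H_add: "H (f \<oplus>\<^bsub>?F\<^esub> f') = H f \<oplus>\<^bsub>P\<^esub> H f'" if f: "f \<in> carrier ?F" "f' \<in> carrier ?F" for f f'
  proof -
    let ?T = "{x. f x \<noteq> \<zero>\<^bsub>S\<^esub>} \<union> {x. f' x \<noteq> \<zero>\<^bsub>S\<^esub>}"
    have T: "finite ?T" "?T \<subseteq> carrier M" using Fc[OF f(1)] Fc[OF f(2)] by auto
    have "H (f \<oplus>\<^bsub>?F\<^esub> f') = (\<Oplus>\<^bsub>P\<^esub>x\<in>?T. (f \<oplus>\<^bsub>?F\<^esub> f') x \<odot>\<^bsub>P\<^esub> g x)"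
      using f T by (intro H_eq F.a_closed) (auto simp: free_module_def)
    also have "\<dots> = (\<Oplus>\<^bsub>P\<^esub>x\<in>?T. f x \<odot>\<^bsub>P\<^esub> g x \<oplus>\<^bsub>P\<^esub> f' x \<odot>\<^bsub>P\<^esub> g x)"
      using f T Fc[OF f(1)] Fc[OF f(2)] by (intro P.add.finprod_cong') (auto simp: free_module_def P.smult_l_distr subset_iff)
    also have "\<dots> = H f \<oplus>\<^bsub>P\<^esub> H f'"
      using f T Fc[OF f(1)] Fc[OF f(2)] by (subst P.finsum_addf) (auto simp: H_eq[where T = ?T] subset_iff)
    finally show ?thesis .
  qed
  have H_smult: "H (s \<odot>\<^bsub>?F\<^esub> f) = s \<odot>\<^bsub>P\<^esub> H f" if f: "f \<in> carrier ?F" and s: "s \<in> carrier S" for f s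
  proof -
    let ?T = "{x. f x \<noteq> \<zero>\<^bsub>S\<^esub>}"
    have T: "finite ?T" "?T \<subseteq> carrier M" using Fc[OF f] by auto
    have "H (s \<odot>\<^bsub>?F\<^esub> f) = (\<Oplus>\<^bsub>P\<^esub>x\<in>?T. (s \<odot>\<^bsub>?F\<^esub> f) x \<odot>\<^bsub>P\<^esub> g x)"
      using f T s by (intro H_eq F.smult_closed) (auto simp: free_module_def)
    also have "\<dots> = (\<Oplus>\<^bsub>P\<^esub>x\<in>?T. s \<odot>\<^bsub>P\<^esub> (f x \<odot>\<^bsub>P\<^esub> g x))"
      using f T Fc[OF f] s by (intro P.add.finprod_cong') (auto simp: free_module_def P.smult_assoc1 subset_iff)
    also have "\<dots> = s \<odot>\<^bsub>P\<^esub> H f"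
      unfolding H_def using f T Fc[OF f] s by (subst P.finsum_smult_ldistr) auto
    finally show ?thesis .
  qed
  have H_gen: "H (free_gen S x) = g x" if x: "x \<in> carrier M" for x
  proof -
    have "H (free_gen S x) = (\<Oplus>\<^bsub>P\<^esub>y\<in>{x}. free_gen S x y \<odot>\<^bsub>P\<^esub> g y)"
      using x gen[OF x] by (intro H_eq) (simp_all, auto simp: free_gen_def)
    then show ?thesis using x by (simp add: free_gen_def)
  qed
  have H_minus: "H (f \<ominus>\<^bsub>?F\<^esub> f') = H f \<ominus>\<^bsub>P\<^esub> H f'" if f: "f \<in> carrier ?F" "f' \<in> carrier ?F" for f f'
  proof -
    have "H (f \<ominus>\<^bsub>?F\<^esub> f') \<oplus>\<^bsub>P\<^esub> H f' = H f"
      using f by (subst H_add[symmetric]) (auto simp: F.minus_eq F.a_assoc F.l_neg)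
    then show ?thesis using f H_closed
      by (metis F.minus_closed P.add.inv_solve_right P.minus_eq)
  qed
  have H_zero: "H \<zero>\<^bsub>?F\<^esub> = \<zero>\<^bsub>P\<^esub>" by (simp add: H_def free_module_def)
  have "submodule {f \<in> carrier ?F. H f = \<zero>\<^bsub>P\<^esub>} S ?F"
  proof (rule F.submoduleI)
    fix f assume "f \<in> {f \<in> carrier ?F. H f = \<zero>\<^bsub>P\<^esub>}"
    then show "\<ominus>\<^bsub>?F\<^esub> f \<in> {f \<in> carrier ?F. H f = \<zero>\<^bsub>P\<^esub>}"
      using H_minus[of "\<zero>\<^bsub>?F\<^esub>" f] by (auto simp: H_zero F.minus_eq P.minus_eq)
  qed (auto simp: H_zero H_add H_smult)
  moreover have "base_change_relations S \<phi> R M \<subseteq> {f \<in> carrier ?F. H f = \<zero>\<^bsub>P\<^esub>}"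
    using base_change_relations_carrier[OF M S \<phi>]
    by (auto simp: base_change_relations_def Let_def H_minus H_add H_smult H_gen g_add g_smult P.r_neg P.minus_eq)
  ultimately have K0: "f \<in> ?K \<Longrightarrow> H f = \<zero>\<^bsub>P\<^esub>" for f
    unfolding base_change_kernel_def generated_submodule_def by blast
  note Kc = F.submoduleE(1)[OF Ksub]
  define h where "h = (\<lambda>X\<in>carrier B. H (SOME f. f \<in> X))"
  have carr: "carrier B = (\<lambda>f. ?K +>\<^bsub>?F\<^esub> f) ` carrier ?F"
    by (auto simp: B_def base_change_def quotient_module_def A_RCOSETS_def')
  have h: "h (?K +>\<^bsub>?F\<^esub> f) = H f" if f: "f \<in> carrier ?F" for f
  proof -
    have "\<zero>\<^bsub>?F\<^esub> \<in> ?K" using subgroup.one_closed[OF submodule.axioms(1)[OF Ksub]] by simp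
    then have "f \<in> ?K +>\<^bsub>?F\<^esub> f" using f F.l_zero[of f] by (force simp: a_r_coset_def')
    then have "(SOME u. u \<in> ?K +>\<^bsub>?F\<^esub> f) \<in> ?K +>\<^bsub>?F\<^esub> f" by (rule someI[of "\<lambda>u. u \<in> ?K +>\<^bsub>?F\<^esub> f"])
    then obtain k where k: "k \<in> ?K" "(SOME u. u \<in> ?K +>\<^bsub>?F\<^esub> f) = k \<oplus>\<^bsub>?F\<^esub> f"
      by (auto simp: a_r_coset_def')
    then have "H (SOME u. u \<in> ?K +>\<^bsub>?F\<^esub> f) = H f"
      using f Kc K0[of k] H_closed by (auto simp: H_add subset_iff)
    then show ?thesis using f by (auto simp: h_def carr)
  qed
  note q = quotient_module_is_module[OF F.module_axioms Ksub, folded base_change_def, folded B_def]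
  show ?thesis
  proof (rule ex1I[of _ h])
    show "h \<in> carrier B \<rightarrow>\<^sub>E carrier P \<and>
    (\<forall>X\<in>carrier B. \<forall>Y\<in>carrier B. h (X \<oplus>\<^bsub>B\<^esub> Y) = h X \<oplus>\<^bsub>P\<^esub> h Y) \<and>
    (\<forall>s\<in>carrier S. \<forall>X\<in>carrier B. h (s \<odot>\<^bsub>B\<^esub> X) = s \<odot>\<^bsub>P\<^esub> h X) \<and>
    (\<forall>x\<in>carrier M. h (base_change_unit S \<phi> R M x) = g x)"
    proof (intro conjI)
      show "h \<in> carrier B \<rightarrow>\<^sub>E carrier P"
      proof (rule PiE_I)
        show "h X \<in> carrier P" if "X \<in> carrier B" for X using that h H_closed by (auto simp: carr)
      qed (simp add: h_def)
    qed (auto simp: carr q h H_add H_smult H_gen base_change_unit_def)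
  next
    fix h' assume h': "h' \<in> carrier B \<rightarrow>\<^sub>E carrier P \<and>
    (\<forall>X\<in>carrier B. \<forall>Y\<in>carrier B. h' (X \<oplus>\<^bsub>B\<^esub> Y) = h' X \<oplus>\<^bsub>P\<^esub> h' Y) \<and>
    (\<forall>s\<in>carrier S. \<forall>X\<in>carrier B. h' (s \<odot>\<^bsub>B\<^esub> X) = s \<odot>\<^bsub>P\<^esub> h' X) \<and>
    (\<forall>x\<in>carrier M. h' (base_change_unit S \<phi> R M x) = g x)"
    have gen': "h' (?K +>\<^bsub>?F\<^esub> (a \<odot>\<^bsub>?F\<^esub> free_gen S x)) = a \<odot>\<^bsub>P\<^esub> g x"
      if "a \<in> carrier S" "x \<in> carrier M" for a x
    proof -
      have "h' (a \<odot>\<^bsub>B\<^esub> (?K +>\<^bsub>?F\<^esub> free_gen S x)) = a \<odot>\<^bsub>P\<^esub> h' (?K +>\<^bsub>?F\<^esub> free_gen S x)"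
        using h' that by (auto simp: carr)
      then show ?thesis using h' that q(3)[of a "free_gen S x"] by (simp add: base_change_unit_def)
    qed
    have "h' (?K +>\<^bsub>?F\<^esub> f) = H f" if "f \<in> carrier ?F" for f
      using S that
    proof (induction rule: free_module_induct)
      case zero
      have "h' (?K +>\<^bsub>?F\<^esub> (\<zero>\<^bsub>S\<^esub> \<odot>\<^bsub>?F\<^esub> free_gen S \<zero>\<^bsub>M\<^esub>)) = \<zero>\<^bsub>P\<^esub>" by (subst gen') auto
      moreover have "\<zero>\<^bsub>S\<^esub> \<odot>\<^bsub>?F\<^esub> free_gen S \<zero>\<^bsub>M\<^esub> = \<zero>\<^bsub>?F\<^esub>" by simp
      ultimately show ?case using H_zero by (simp add: free_module_def)
    next
      case (gen a x)
      then show ?case by (simp add: gen' H_smult H_gen)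
    next
      case (add f f')
      then have "h' ((?K +>\<^bsub>?F\<^esub> f) \<oplus>\<^bsub>B\<^esub> (?K +>\<^bsub>?F\<^esub> f')) = H f \<oplus>\<^bsub>P\<^esub> H f'"
        using h' by (auto simp: carr)
      then show ?case using add q(2)[of f f'] by (simp add: H_add)
    qed
    then have eq: "h' X = h X" if "X \<in> carrier B" for X using that h by (auto simp: carr)
    show "h' = h"
    proof (rule extensionalityI[OF _ _ eq])
      show "h' \<in> extensional (carrier B)" using h' by (simp add: PiE_iff)
    qed (simp only: h_def restrict_extensional)
  qed
qed


section \<open>Frobenius closure and its special part\<close>

text \<open>Throughout, \<open>p\<close> is the characteristic of \<open>R\<close> and \<open>q = p\<^sup>e\<close>.\<close>

definition frobenius :: "('a, 'c) ring_scheme \<Rightarrow> nat \<Rightarrow> 'a \<Rightarrow> 'a"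
  where "frobenius R p a = a [^]\<^bsub>R\<^esub> p"

definition frobenius_module ::
  "('a, 'c) ring_scheme \<Rightarrow> nat \<Rightarrow> nat \<Rightarrow> ('a, 'b, 'd) module_scheme
    \<Rightarrow> ('a, ('b \<Rightarrow> 'a) set) module"
  where "frobenius_module R p e M = base_change R (frobenius R p ^^ e) R M"

definition frobenius_power ::
  "('a, 'c) ring_scheme \<Rightarrow> nat \<Rightarrow> nat \<Rightarrow> ('a, 'b, 'd) module_scheme \<Rightarrow> 'b \<Rightarrow> ('b \<Rightarrow> 'a) set"
  where "frobenius_power R p e M z = base_change_unit R (frobenius R p ^^ e) R M z"

definition bracket_power ::
  "('a, 'c) ring_scheme \<Rightarrow> nat \<Rightarrow> nat \<Rightarrow> ('a, 'b, 'd) module_scheme \<Rightarrow> 'b set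
    \<Rightarrow> ('b \<Rightarrow> 'a) set set"
  where "bracket_power R p e M N =
    generated_submodule R (frobenius_module R p e M) (frobenius_power R p e M ` N)"

definition frobenius_closure ::
  "('a, 'c) ring_scheme \<Rightarrow> nat \<Rightarrow> ('a, 'b, 'd) module_scheme \<Rightarrow> 'b set \<Rightarrow> 'b set"
  where "frobenius_closure R p M N =
    {z \<in> carrier M. \<exists>e. frobenius_power R p e M z \<in> bracket_power R p e M N}"

definition special_frobenius_closure ::
  "('a, 'c) ring_scheme \<Rightarrow> 'a set \<Rightarrow> nat \<Rightarrow> ('a, 'b, 'd) module_scheme \<Rightarrow> 'b set \<Rightarrow> 'b set"
  where "special_frobenius_closure R \<mm> p M N =
    {z \<in> carrier M. \<exists>e. frobenius_power R p e M z
       \<in> ideal_smult R (frobenius_module R p e M) \<mm> (bracket_power R p e M N)}"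

definition special_part ::
  "('a, 'c) ring_scheme \<Rightarrow> 'a set \<Rightarrow> ('a, 'b, 'd) module_scheme
    \<Rightarrow> ('b set \<Rightarrow> 'b set) \<Rightarrow> ('b set \<Rightarrow> 'b set) \<Rightarrow> bool"
  where "special_part R \<mm> M cl sp \<longleftrightarrow>
    (\<forall>L N. submodule L R M \<longrightarrow> submodule N R M \<longrightarrow>
      submodule (sp L) R M \<and>
      ideal_smult R M \<mm> L \<subseteq> sp L \<and> sp L \<subseteq> cl L \<and>
      sp (cl L) = sp L \<and> cl (sp L) = sp L \<and>
      (L \<subseteq> N \<and> N \<subseteq> cl (L <+>\<^bsub>M\<^esub> sp N) \<longrightarrow> N \<subseteq> cl L))"

end

theory Submission
  imports Defs
begin

text \<open>The Frobenius endomorphism, which is a ring homomorphism because \<open>p\<close> divides the binomial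
  coefficients, induces semilinear maps \<open>F\<^sup>e(M) \<rightarrow> F\<^sup>e\<^sup>+\<^sup>1(M)\<close> with \<open>z\<^sup>q \<mapsto> z\<^sup>p\<^sup>q\<close>. A family \<open>K\<close> of
  submodules \<open>K\<^sub>e \<subseteq> F\<^sup>e(M)\<close> stable under these maps has a limit: the submodule of all \<open>z\<close> such that
  \<open>z\<^sup>q \<in> K\<^sub>e\<close> for some, equivalently every large, \<open>e\<close>. Both \<open>N\<^sup>F\<close> and \<open>N\<^sup>F\<^sup>s\<^sup>p\<close> are such limits, and the
  elements of \<open>F\<^sup>e(M)\<close> which are eventually mapped into \<open>K\<close> form a submodule. Hence one may check on
  generators that a bracket power lies in it, and this gives part (3). In part (4) the limit of
  \<open>L\<^bsup>[q]\<^esup> + \<mm> N\<^bsup>[q]\<^esup>\<close> contains \<open>N\<close>; as \<open>N\<close> is finitely generated, a single \<open>q\<close> serves for all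
  generators, and Nakayama's lemma yields \<open>N\<^bsup>[q]\<^esup> \<subseteq> L\<^bsup>[q]\<^esup>\<close>.\<close>


section \<open>Finitely generated submodules\<close>

lemma (in abelian_group) minus_zero_right [simp]: "x \<in> carrier G \<Longrightarrow> x \<ominus> \<zero> = x"
  by (simp add: minus_eq add.inv_one)

lemma (in abelian_group) minus_self [simp]: "x \<in> carrier G \<Longrightarrow> x \<ominus> x = \<zero>"
  by (simp add: minus_eq r_neg)

lemma generated_submodule_incl: "S \<subseteq> generated_submodule R M S"
  unfolding generated_submodule_def by blast

lemma generated_submodule_minimal:
  "submodule H R M \<Longrightarrow> S \<subseteq> H \<Longrightarrow> generated_submodule R M S \<subseteq> H"
  unfolding generated_submodule_def by blast

lemma generated_submodule_mono:
  "S \<subseteq> T \<Longrightarrow> generated_submodule R M S \<subseteq> generated_submodule R M T"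
  unfolding generated_submodule_def by blast

lemma ideal_smult_incl: "a \<in> I \<Longrightarrow> x \<in> N \<Longrightarrow> a \<odot>\<^bsub>P\<^esub> x \<in> ideal_smult R P I N"
  unfolding ideal_smult_def
  using generated_submodule_incl[of "{a \<odot>\<^bsub>P\<^esub> x |a x. a \<in> I \<and> x \<in> N}" R P] by blast

lemma ideal_smult_mono: "N \<subseteq> N' \<Longrightarrow> ideal_smult R P I N \<subseteq> ideal_smult R P I N'"
  unfolding ideal_smult_def by (rule generated_submodule_mono) blast

lemma ideal_smult_subset:
  assumes "submodule N R P" "I \<subseteq> carrier R"
  shows "ideal_smult R P I N \<subseteq> N"
  unfolding ideal_smult_def
  using submodule.smult_closed[OF assms(1)] assms(2)
  by (intro generated_submodule_minimal[OF assms(1)]) auto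

lemma (in module) submodule_zero_closed: "submodule H R M \<Longrightarrow> \<zero>\<^bsub>M\<^esub> \<in> H"
  using subgroup.one_closed[OF submodule.axioms(1)] by fastforce

lemma (in module) submodule_minus_closed:
  "submodule H R M \<Longrightarrow> x \<in> H \<Longrightarrow> y \<in> H \<Longrightarrow> x \<ominus>\<^bsub>M\<^esub> y \<in> H"
  by (simp add: M.minus_eq submoduleE)

lemma (in module) submodule_Int:
  assumes "submodule H R M" "submodule K R M"
  shows "submodule (H \<inter> K) R M"
  using submoduleE[OF assms(1)] submoduleE[OF assms(2)] assms submodule_zero_closed
  by (intro submoduleI) auto

text \<open>Additivity alone controls zero and negatives, and closure under scalars only asks that
  \<open>\<phi> a\<close> be a scalar for \<open>P\<close>. The uses take for \<open>f\<close> the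
  map z to z^q, a transition map or an iterate of transitions, each semilinear along a power of
  Frobenius.\<close>

lemma submodule_semilinear_preimage:
  assumes M: "Module.module R M" and P: "Module.module S P"
    and f: "f \<in> carrier M \<rightarrow> carrier P" and \<phi>: "\<phi> \<in> carrier R \<rightarrow> carrier S"
    and add: "\<And>x y. x \<in> carrier M \<Longrightarrow> y \<in> carrier M \<Longrightarrow> f (x \<oplus>\<^bsub>M\<^esub> y) = f x \<oplus>\<^bsub>P\<^esub> f y"
    and smult: "\<And>a x. a \<in> carrier R \<Longrightarrow> x \<in> carrier M \<Longrightarrow> f (a \<odot>\<^bsub>M\<^esub> x) = \<phi> a \<odot>\<^bsub>P\<^esub> f x"
    and K: "submodule K S P"
  shows "submodule {x \<in> carrier M. f x \<in> K} R M"
proof -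
  interpret M: Module.module R M by fact
  interpret P: Module.module S P by fact
  note fc = funcset_mem[OF f] and K' = P.submoduleE[OF K]
  have z: "f \<zero>\<^bsub>M\<^esub> = \<zero>\<^bsub>P\<^esub>"
    using add[of "\<zero>\<^bsub>M\<^esub>" "\<zero>\<^bsub>M\<^esub>"] fc[of "\<zero>\<^bsub>M\<^esub>"] by (simp add: P.M.add.r_cancel_one')
  have inv: "f (\<ominus>\<^bsub>M\<^esub> x) = \<ominus>\<^bsub>P\<^esub> f x" if x: "x \<in> carrier M" for x
  proof -
    have "f (\<ominus>\<^bsub>M\<^esub> x) \<oplus>\<^bsub>P\<^esub> f x = \<zero>\<^bsub>P\<^esub>"
      using add[of "\<ominus>\<^bsub>M\<^esub> x" x] x z by (simp add: M.M.l_neg)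
    then show ?thesis using fc x by (simp add: P.M.minus_equality)
  qed
  show ?thesis
    using K' z inv add smult funcset_mem[OF \<phi>] P.submodule_zero_closed[OF K]
    by (intro M.submoduleI) auto
qed

text \<open>The set is H + I x, expressed by congruences modulo \<open>H\<close>. With I = R it
  adjoins a generator \<open>x\<close> to \<open>H\<close>; with I = \<open>\<mm>\<close> it enters
  Nakayama's lemma.\<close>

lemma (in module) submodule_congruent_multiples:
  assumes H: "submodule H R M" and I: "ideal I R" and x: "x \<in> carrier M"
  shows "submodule {v \<in> carrier M. \<exists>a\<in>I. v \<ominus>\<^bsub>M\<^esub> a \<odot>\<^bsub>M\<^esub> x \<in> H} R M"
proof -
  interpret I: ideal I R by fact
  note H' = submoduleE[OF H] and Ic = I.Icarr
  show ?thesis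
  proof (rule submoduleI)
    show "\<zero>\<^bsub>M\<^esub> \<in> {v \<in> carrier M. \<exists>a\<in>I. v \<ominus>\<^bsub>M\<^esub> a \<odot>\<^bsub>M\<^esub> x \<in> H}"
      using x submodule_zero_closed[OF H] by (auto intro!: bexI[of _ "\<zero>"])
  next
    fix v assume "v \<in> {v \<in> carrier M. \<exists>a\<in>I. v \<ominus>\<^bsub>M\<^esub> a \<odot>\<^bsub>M\<^esub> x \<in> H}"
    then obtain a where v: "v \<in> carrier M" "a \<in> I" "v \<ominus>\<^bsub>M\<^esub> a \<odot>\<^bsub>M\<^esub> x \<in> H" by blast
    have "\<ominus>\<^bsub>M\<^esub> v \<ominus>\<^bsub>M\<^esub> (\<ominus> a) \<odot>\<^bsub>M\<^esub> x = \<ominus>\<^bsub>M\<^esub> (v \<ominus>\<^bsub>M\<^esub> a \<odot>\<^bsub>M\<^esub> x)"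
      using v x Ic by (simp add: smult_l_minus M.minus_eq M.minus_add)
    then show "\<ominus>\<^bsub>M\<^esub> v \<in> {v \<in> carrier M. \<exists>a\<in>I. v \<ominus>\<^bsub>M\<^esub> a \<odot>\<^bsub>M\<^esub> x \<in> H}"
      using v H' by (auto intro!: bexI[of _ "\<ominus> a"])
  next
    fix v w assume "v \<in> {v \<in> carrier M. \<exists>a\<in>I. v \<ominus>\<^bsub>M\<^esub> a \<odot>\<^bsub>M\<^esub> x \<in> H}"
      "w \<in> {v \<in> carrier M. \<exists>a\<in>I. v \<ominus>\<^bsub>M\<^esub> a \<odot>\<^bsub>M\<^esub> x \<in> H}"
    then obtain a b where v: "v \<in> carrier M" "a \<in> I" "v \<ominus>\<^bsub>M\<^esub> a \<odot>\<^bsub>M\<^esub> x \<in> H"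
      and w: "w \<in> carrier M" "b \<in> I" "w \<ominus>\<^bsub>M\<^esub> b \<odot>\<^bsub>M\<^esub> x \<in> H" by blast
    have "v \<oplus>\<^bsub>M\<^esub> w \<ominus>\<^bsub>M\<^esub> (a \<oplus> b) \<odot>\<^bsub>M\<^esub> x = (v \<ominus>\<^bsub>M\<^esub> a \<odot>\<^bsub>M\<^esub> x) \<oplus>\<^bsub>M\<^esub> (w \<ominus>\<^bsub>M\<^esub> b \<odot>\<^bsub>M\<^esub> x)"
      using v w x Ic by (simp add: smult_l_distr M.minus_eq M.minus_add M.a_ac)
    then show "v \<oplus>\<^bsub>M\<^esub> w \<in> {v \<in> carrier M. \<exists>a\<in>I. v \<ominus>\<^bsub>M\<^esub> a \<odot>\<^bsub>M\<^esub> x \<in> H}"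
      using v w H' by (auto intro!: bexI[of _ "a \<oplus> b"])
  next
    fix c v assume c: "c \<in> carrier R" and "v \<in> {v \<in> carrier M. \<exists>a\<in>I. v \<ominus>\<^bsub>M\<^esub> a \<odot>\<^bsub>M\<^esub> x \<in> H}"
    then obtain a where v: "v \<in> carrier M" "a \<in> I" "v \<ominus>\<^bsub>M\<^esub> a \<odot>\<^bsub>M\<^esub> x \<in> H" by blast
    have "c \<odot>\<^bsub>M\<^esub> v \<ominus>\<^bsub>M\<^esub> (c \<otimes> a) \<odot>\<^bsub>M\<^esub> x = c \<odot>\<^bsub>M\<^esub> (v \<ominus>\<^bsub>M\<^esub> a \<odot>\<^bsub>M\<^esub> x)"
      using v x c Ic by (simp add: smult_r_distr smult_r_minus smult_assoc1 M.minus_eq)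
    then show "c \<odot>\<^bsub>M\<^esub> v \<in> {v \<in> carrier M. \<exists>a\<in>I. v \<ominus>\<^bsub>M\<^esub> a \<odot>\<^bsub>M\<^esub> x \<in> H}"
      using v c H' by (auto intro!: bexI[of _ "c \<otimes> a"] I.I_l_closed)
  qed auto
qed

text \<open>This is the colon ideal (W + H : x): the coefficients at \<open>x\<close> of elements of
  \<open>W\<close> modulo \<open>H\<close>. It acts as a leading coefficient ideal when a generator
  \<open>x\<close> is split off.\<close>

lemma (in module) ideal_congruent_multiples:
  assumes H: "submodule H R M" and W: "submodule W R M" and x: "x \<in> carrier M"
  shows "ideal {a \<in> carrier R. \<exists>w\<in>W. w \<ominus>\<^bsub>M\<^esub> a \<odot>\<^bsub>M\<^esub> x \<in> H} R"
proof -
  note H' = submoduleE[OF H] and W' = submoduleE[OF W]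
  have Wc: "\<And>w. w \<in> W \<Longrightarrow> w \<in> carrier M" using W'(1) by blast
  let ?I = "{a \<in> carrier R. \<exists>w\<in>W. w \<ominus>\<^bsub>M\<^esub> a \<odot>\<^bsub>M\<^esub> x \<in> H}"
  have mult: "c \<otimes> a \<in> ?I" if c: "c \<in> carrier R" and a: "a \<in> ?I" for a c
  proof -
    from a obtain w where a: "a \<in> carrier R" "w \<in> W" "w \<ominus>\<^bsub>M\<^esub> a \<odot>\<^bsub>M\<^esub> x \<in> H" by blast
    have "c \<odot>\<^bsub>M\<^esub> w \<ominus>\<^bsub>M\<^esub> (c \<otimes> a) \<odot>\<^bsub>M\<^esub> x = c \<odot>\<^bsub>M\<^esub> (w \<ominus>\<^bsub>M\<^esub> a \<odot>\<^bsub>M\<^esub> x)"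
      using a x c Wc by (simp add: smult_r_distr smult_r_minus smult_assoc1 M.minus_eq)
    then show ?thesis using a c H' W' by (auto intro!: bexI[of _ "c \<odot>\<^bsub>M\<^esub> w"])
  qed
  have mult': "a \<otimes> c \<in> ?I" if "c \<in> carrier R" "a \<in> ?I" for a c
    using mult[OF that] that R.m_comm[of a c] by simp
  show ?thesis
  proof (rule idealI[OF R.ring_axioms _ mult mult'])
    show "subgroup ?I (add_monoid R)"
    proof (rule R.add.subgroupI)
      have "\<zero> \<in> ?I"
        using x submodule_zero_closed[OF H] submodule_zero_closed[OF W]
        by (auto intro!: bexI[of _ "\<zero>\<^bsub>M\<^esub>"])
      then show "?I \<noteq> {}" by blast
    next
      fix a assume a: "a \<in> ?I"
      then show "\<ominus> a \<in> ?I" using mult[of "\<ominus> \<one>" a] by (auto simp: R.l_minus)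
    next
      fix a b assume "a \<in> ?I" "b \<in> ?I"
      then obtain v w where a: "a \<in> carrier R" "v \<in> W" "v \<ominus>\<^bsub>M\<^esub> a \<odot>\<^bsub>M\<^esub> x \<in> H"
        and b: "b \<in> carrier R" "w \<in> W" "w \<ominus>\<^bsub>M\<^esub> b \<odot>\<^bsub>M\<^esub> x \<in> H" by blast
      have "v \<oplus>\<^bsub>M\<^esub> w \<ominus>\<^bsub>M\<^esub> (a \<oplus> b) \<odot>\<^bsub>M\<^esub> x = (v \<ominus>\<^bsub>M\<^esub> a \<odot>\<^bsub>M\<^esub> x) \<oplus>\<^bsub>M\<^esub> (w \<ominus>\<^bsub>M\<^esub> b \<odot>\<^bsub>M\<^esub> x)"
        using a b x Wc by (simp add: smult_l_distr M.minus_eq M.minus_add M.a_ac)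
      then show "a \<oplus> b \<in> ?I" using a b H' W' by (auto intro!: bexI[of _ "v \<oplus>\<^bsub>M\<^esub> w"])
    qed auto
  qed
qed

text \<open>As in Hilbert's basis theorem, a generator \<open>x\<close> is split off: finitely many
  elements of \<open>N\<close> realise generators of the ideal of coefficients at \<open>x\<close>,
  and what remains lies in \<open>N \<inter> G\<close>, where the induction hypothesis applies.
  Bounding \<open>N\<close> by the span of \<open>S\<close>, instead of letting \<open>S\<close>
  span \<open>M\<close>, lets the induction pass to \<open>N \<inter> G\<close>.\<close>

lemma (in module) submodule_finitely_generated:
  assumes noeth: "noetherian_ring R" and "finite S" "S \<subseteq> carrier M"
    and "submodule N R M" "N \<subseteq> generated_submodule R M S"
  shows "\<exists>T. finite T \<and> T \<subseteq> N \<and> generated_submodule R M T = N"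
  using assms(2-)
proof (induction S arbitrary: N rule: finite_induct)
  case empty
  have "submodule {\<zero>\<^bsub>M\<^esub>} R M" by (rule submoduleI) auto
  then have "generated_submodule R M {} \<subseteq> {\<zero>\<^bsub>M\<^esub>}" by (rule generated_submodule_minimal) auto
  moreover have "generated_submodule R M {} \<subseteq> N"
    by (rule generated_submodule_minimal) (use empty in auto)
  moreover have "\<zero>\<^bsub>M\<^esub> \<in> generated_submodule R M {}"
    by (intro submodule_zero_closed generated_submodule_is_submodule) auto
  ultimately show ?case using empty by (intro exI[of _ "{}"]) auto
next
  case (insert x S N)
  note N = \<open>submodule N R M\<close>
  have x: "x \<in> carrier M" and S: "S \<subseteq> carrier M" using insert.prems by auto
  define G where "G = generated_submodule R M S"
  have G: "submodule G R M" unfolding G_def by (rule generated_submodule_is_submodule) (rule S)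
  define I where "I = {a \<in> carrier R. \<exists>w\<in>N. w \<ominus>\<^bsub>M\<^esub> a \<odot>\<^bsub>M\<^esub> x \<in> G}"
  have "ideal I R" unfolding I_def by (rule ideal_congruent_multiples[OF G N x])
  then obtain A where A: "A \<subseteq> carrier R" "finite A" "I = Idl A"
    using noetherian_ring.finetely_gen[OF noeth] by blast
  have "\<forall>a\<in>A. \<exists>w\<in>N. w \<ominus>\<^bsub>M\<^esub> a \<odot>\<^bsub>M\<^esub> x \<in> G"
    using R.genideal_self[OF A(1)] A(3) unfolding I_def by blast
  then obtain w where w: "\<And>a. a \<in> A \<Longrightarrow> w a \<in> N" "\<And>a. a \<in> A \<Longrightarrow> w a \<ominus>\<^bsub>M\<^esub> a \<odot>\<^bsub>M\<^esub> x \<in> G"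
    by metis
  obtain T where T: "finite T" "T \<subseteq> N \<inter> G" "generated_submodule R M T = N \<inter> G"
    using insert.IH[OF S submodule_Int[OF N G]] unfolding G_def by blast
  let ?T = "T \<union> w ` A"
  have TN: "?T \<subseteq> N" using T w by auto
  have Nc: "N \<subseteq> carrier M" using submoduleE[OF N] by blast
  have sub: "submodule (generated_submodule R M ?T) R M"
    by (rule generated_submodule_is_submodule) (use TN Nc in blast)
  let ?W = "generated_submodule R M (w ` A)"
  have W: "submodule ?W R M"
    by (rule generated_submodule_is_submodule) (use TN Nc in blast)
  have WN: "?W \<subseteq> N" by (rule generated_submodule_minimal[OF N]) (use TN in blast)
  \<comment> \<open>The coefficient ideal of \<open>?W\<close> contains \<open>A\<close>, hence all
    of \<open>I\<close>: every coefficient attained by \<open>N\<close> is attained in the span of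
    the lifts \<open>w a\<close>. This replaces an explicit linear combination.\<close>
  have "I \<subseteq> {a \<in> carrier R. \<exists>v\<in>?W. v \<ominus>\<^bsub>M\<^esub> a \<odot>\<^bsub>M\<^esub> x \<in> G}"
    unfolding A(3)
    by (rule R.genideal_minimal[OF ideal_congruent_multiples[OF G W x]])
      (use A(1) w generated_submodule_incl[of "w ` A" R M] in blast)
  moreover have "N \<subseteq> {v \<in> carrier M. \<exists>a\<in>carrier R. v \<ominus>\<^bsub>M\<^esub> a \<odot>\<^bsub>M\<^esub> x \<in> G}"
  proof (rule subset_trans[OF insert.prems(3)], rule generated_submodule_minimal)
    show "submodule {v \<in> carrier M. \<exists>a\<in>carrier R. v \<ominus>\<^bsub>M\<^esub> a \<odot>\<^bsub>M\<^esub> x \<in> G} R M"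
      by (rule submodule_congruent_multiples[OF G R.oneideal x])
    have "x \<ominus>\<^bsub>M\<^esub> \<one> \<odot>\<^bsub>M\<^esub> x \<in> G" using x submodule_zero_closed[OF G] by simp
    moreover have "s \<ominus>\<^bsub>M\<^esub> \<zero> \<odot>\<^bsub>M\<^esub> x \<in> G" if "s \<in> S" for s
      using that subsetD[OF S that] generated_submodule_incl[of S R M] x unfolding G_def by auto
    ultimately show "insert x S \<subseteq> {v \<in> carrier M. \<exists>a\<in>carrier R. v \<ominus>\<^bsub>M\<^esub> a \<odot>\<^bsub>M\<^esub> x \<in> G}"
      using x S by blast
  qed
  ultimately have key: "\<exists>v\<in>?W. \<exists>a\<in>carrier R. v \<ominus>\<^bsub>M\<^esub> a \<odot>\<^bsub>M\<^esub> x \<in> G \<and> n \<ominus>\<^bsub>M\<^esub> a \<odot>\<^bsub>M\<^esub> x \<in> G"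
    if "n \<in> N" for n using that unfolding I_def by blast
  have "N \<subseteq> generated_submodule R M ?T"
  proof
    fix n assume n: "n \<in> N"
    then obtain v a where v: "v \<in> ?W" "a \<in> carrier R" "v \<ominus>\<^bsub>M\<^esub> a \<odot>\<^bsub>M\<^esub> x \<in> G" "n \<ominus>\<^bsub>M\<^esub> a \<odot>\<^bsub>M\<^esub> x \<in> G"
      using key by blast
    have c: "n \<in> carrier M" "v \<in> carrier M" using n v Nc WN by auto
    \<comment> \<open>\<open>n\<close> and \<open>v\<close> are congruent modulo \<open>G\<close> to
      the same multiple of \<open>x\<close>, so their difference falls into
      \<open>N \<inter> G\<close>, which \<open>T\<close> generates.\<close>
    have "(n \<ominus>\<^bsub>M\<^esub> a \<odot>\<^bsub>M\<^esub> x) \<ominus>\<^bsub>M\<^esub> (v \<ominus>\<^bsub>M\<^esub> a \<odot>\<^bsub>M\<^esub> x) = n \<ominus>\<^bsub>M\<^esub> v"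
    proof -
      have "(n \<ominus>\<^bsub>M\<^esub> a \<odot>\<^bsub>M\<^esub> x) \<ominus>\<^bsub>M\<^esub> (v \<ominus>\<^bsub>M\<^esub> a \<odot>\<^bsub>M\<^esub> x) =
          (n \<ominus>\<^bsub>M\<^esub> v) \<oplus>\<^bsub>M\<^esub> (a \<odot>\<^bsub>M\<^esub> x \<oplus>\<^bsub>M\<^esub> \<ominus>\<^bsub>M\<^esub> (a \<odot>\<^bsub>M\<^esub> x))"
        using c v x by (simp add: M.minus_eq M.minus_add M.a_ac del: M.r_neg)
      then show ?thesis using c v x by (simp add: M.r_neg)
    qed
    then have "n \<ominus>\<^bsub>M\<^esub> v \<in> N \<inter> G"
      using submodule_minus_closed[OF G v(4) v(3)] submodule_minus_closed[OF N n] v WN by auto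
    then have "n \<ominus>\<^bsub>M\<^esub> v \<in> generated_submodule R M ?T"
      using T(3) generated_submodule_mono[of T ?T R M] by blast
    moreover have "v \<in> generated_submodule R M ?T"
      using v generated_submodule_mono[of "w ` A" ?T R M] by blast
    moreover have "n = (n \<ominus>\<^bsub>M\<^esub> v) \<oplus>\<^bsub>M\<^esub> v" using c by (simp add: M.minus_eq M.a_assoc M.l_neg)
    ultimately show "n \<in> generated_submodule R M ?T"
      using submoduleE(5)[OF sub] by metis
  qed
  then have "generated_submodule R M ?T = N"
    using generated_submodule_minimal[OF N TN] by blast
  then show ?case using T A TN by (intro exI[of _ ?T]) auto
qed

section \<open>Nonunits of a local ring and Nakayama's lemma\<close>

text \<open>A nonunit generates a proper ideal. An ideal that is maximal among the proper ideals
  containing it is a maximal ideal, so it is \<open>\<mm>\<close> by uniqueness.\<close>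

lemma local_ring_nonunit_mem:
  fixes R (structure)
  assumes "noetherian_ring R" "local_ring \<mm> R" "a \<in> carrier R" "a \<notin> Units R"
  shows "a \<in> \<mm>"
proof -
  interpret local_ring \<mm> R by fact
  interpret noetherian_ring R by fact
  define P where "P = {J. ideal J R \<and> a \<in> J \<and> \<one> \<notin> J}"
  have "\<one> \<notin> PIdl a"
    using assms(3,4) m_comm unfolding cgenideal_def Units_def by force
  then have P0: "PIdl a \<in> P"
    using assms(3) by (simp add: P_def cgenideal_ideal cgenideal_self)
  have "\<exists>J\<in>P. \<forall>X\<in>P. J \<subseteq> X \<longrightarrow> X = J"
  proof (rule subset_Zorn_nonempty)
    fix C assume C: "C \<noteq> {}" "subset.chain P C"
    then have "subset.chain {I. ideal I R} C"
      by (auto simp: pred_on.chain_def P_def)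
    then have "\<Union>C \<in> C" by (rule ideal_chain_is_trivial[OF C(1)])
    then show "\<Union>C \<in> P" using C(2) by (auto simp: pred_on.chain_def)
  qed (use P0 in auto)
  then obtain J where J: "ideal J R" "a \<in> J" "\<one> \<notin> J"
    and max: "\<And>X. ideal X R \<Longrightarrow> \<one> \<notin> X \<Longrightarrow> J \<subseteq> X \<Longrightarrow> X = J"
    unfolding P_def by blast
  have "maximalideal J R"
  proof (rule maximalidealI[OF J(1)])
    show "carrier R \<noteq> J" using J(3) by auto
    show "X = J \<or> X = carrier R" if "ideal X R" "J \<subseteq> X" "X \<subseteq> carrier R" for X
      using max[OF that(1) _ that(2)] ideal.one_imp_carrier[OF that(1)] by blast
  qed
  then show ?thesis using unique_maximalideal J(2) by blast
qed

text \<open>If the generator eliminated in the induction step is \<open>x = v + a x\<close> with \<open>a \<in> \<mm>\<close>,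
  then \<open>1 - a\<close> is a unit, so \<open>x\<close> lies in the submodule given by the remaining generators.\<close>

lemma (in module) nakayama:
  assumes "noetherian_ring R" and loc: "local_ring \<mm> R"
    and "finite T" "T \<subseteq> carrier M" and K: "submodule K R M"
    and "T \<subseteq> generated_submodule R M (K \<union> ideal_smult R M \<mm> (generated_submodule R M T))"
  shows "T \<subseteq> K"
  using assms(3,4,6)
proof (induction T rule: finite_induct)
  case (insert x T)
  interpret m: local_ring \<mm> R by fact
  have x: "x \<in> carrier M" and T: "T \<subseteq> carrier M" using insert.prems by auto
  have Kc: "K \<subseteq> carrier M" using submoduleE[OF K] by blast
  have mc: "\<And>a. a \<in> \<mm> \<Longrightarrow> a \<in> carrier R" using m.Icarr .
  let ?G = "generated_submodule R M T"
  have G: "submodule ?G R M" by (rule generated_submodule_is_submodule[OF T])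
  have Gc: "?G \<subseteq> carrier M" using submoduleE[OF G] by blast
  have prodc: "{a \<odot>\<^bsub>M\<^esub> y |a y. a \<in> \<mm> \<and> y \<in> ?G} \<subseteq> carrier M" using Gc mc by auto
  have mG: "submodule (ideal_smult R M \<mm> ?G) R M"
    unfolding ideal_smult_def by (rule generated_submodule_is_submodule[OF prodc])
  \<comment> \<open>The induction hypothesis for \<open>T\<close> asks for
    \<open>T \<subseteq> W\<close>, where \<open>W\<close> is K + \<open>\<mm>\<close> G. The
    assumption places \<open>T\<close> only in W + \<open>\<mm>\<close> x, so the multiples of
    \<open>x\<close> have to be absorbed.\<close>
  define W where "W = generated_submodule R M (K \<union> ideal_smult R M \<mm> ?G)"
  have W: "submodule W R M"
    unfolding W_def using Kc submoduleE(1)[OF mG] by (intro generated_submodule_is_submodule) blast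
  have KW: "K \<subseteq> W" and mGW: "ideal_smult R M \<mm> ?G \<subseteq> W"
    using generated_submodule_incl[of "K \<union> ideal_smult R M \<mm> ?G" R M] unfolding W_def by auto
  have smW: "a \<odot>\<^bsub>M\<^esub> y \<in> W" if "a \<in> \<mm>" "y \<in> ?G" for a y
    using mGW that generated_submodule_incl[of "{a \<odot>\<^bsub>M\<^esub> y |a y. a \<in> \<mm> \<and> y \<in> ?G}" R M]
    unfolding ideal_smult_def by blast
  \<comment> \<open>\<open>?D\<close> is W + \<open>\<mm>\<close> x, and \<open>?E\<close> below is
    G + R x, which contains the span of all generators. Multiplying \<open>?E\<close> by
    \<open>\<mm>\<close> therefore lands in \<open>?D\<close>.\<close>
  let ?D = "{v \<in> carrier M. \<exists>a\<in>\<mm>. v \<ominus>\<^bsub>M\<^esub> a \<odot>\<^bsub>M\<^esub> x \<in> W}"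
  have D: "submodule ?D R M" by (rule submodule_congruent_multiples[OF W m.is_ideal x])
  have WD: "W \<subseteq> ?D"
    using x submoduleE(1)[OF W] by (auto intro!: bexI[of _ \<zero>])
  let ?E = "{v \<in> carrier M. \<exists>c\<in>carrier R. v \<ominus>\<^bsub>M\<^esub> c \<odot>\<^bsub>M\<^esub> x \<in> ?G}"
  have "generated_submodule R M (insert x T) \<subseteq> ?E"
  proof (rule generated_submodule_minimal[OF submodule_congruent_multiples[OF G R.oneideal x]])
    have "x \<ominus>\<^bsub>M\<^esub> \<one> \<odot>\<^bsub>M\<^esub> x \<in> ?G" using x submodule_zero_closed[OF G] by simp
    moreover have "s \<ominus>\<^bsub>M\<^esub> \<zero> \<odot>\<^bsub>M\<^esub> x \<in> ?G" if "s \<in> T" for s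
      using that subsetD[OF T that] generated_submodule_incl[of T R M] x by auto
    ultimately show "insert x T \<subseteq> ?E" using x T by blast
  qed
  then have "{a \<odot>\<^bsub>M\<^esub> y |a y. a \<in> \<mm> \<and> y \<in> generated_submodule R M (insert x T)} \<subseteq> ?D"
  proof (clarify)
    fix a y assume a: "a \<in> \<mm>" and "y \<in> generated_submodule R M (insert x T)"
      and "generated_submodule R M (insert x T) \<subseteq> ?E"
    then obtain c where y: "y \<in> carrier M" "c \<in> carrier R" "y \<ominus>\<^bsub>M\<^esub> c \<odot>\<^bsub>M\<^esub> x \<in> ?G" by blast
    have "a \<odot>\<^bsub>M\<^esub> y \<ominus>\<^bsub>M\<^esub> (a \<otimes> c) \<odot>\<^bsub>M\<^esub> x = a \<odot>\<^bsub>M\<^esub> (y \<ominus>\<^bsub>M\<^esub> c \<odot>\<^bsub>M\<^esub> x)"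
      using a y x mc by (simp add: smult_r_distr smult_r_minus smult_assoc1 M.minus_eq)
    then show "a \<odot>\<^bsub>M\<^esub> y \<in> carrier M \<and> (\<exists>b\<in>\<mm>. a \<odot>\<^bsub>M\<^esub> y \<ominus>\<^bsub>M\<^esub> b \<odot>\<^bsub>M\<^esub> x \<in> W)"
      using smW[OF a y(3)] a y mc m.I_r_closed by (auto intro!: bexI[of _ "a \<otimes> c"])
  qed
  then have "ideal_smult R M \<mm> (generated_submodule R M (insert x T)) \<subseteq> ?D"
    unfolding ideal_smult_def by (rule generated_submodule_minimal[OF D])
  then have "generated_submodule R M
      (K \<union> ideal_smult R M \<mm> (generated_submodule R M (insert x T))) \<subseteq> ?D"
    using KW WD by (intro generated_submodule_minimal[OF D]) blast
  then have xTD: "insert x T \<subseteq> ?D" using insert.prems(2) by blast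
  then obtain a where a: "a \<in> \<mm>" "x \<ominus>\<^bsub>M\<^esub> a \<odot>\<^bsub>M\<^esub> x \<in> W" by blast
  let ?u = "\<one> \<ominus> a"
  have ac: "a \<in> carrier R" and uc: "?u \<in> carrier R" using mc a by auto
  have "?u \<in> Units R"
  proof (rule ccontr)
    assume "?u \<notin> Units R"
    then have "?u \<in> \<mm>" by (rule local_ring_nonunit_mem[OF assms(1) loc uc])
    then have "?u \<oplus> a \<in> \<mm>" using a by simp
    moreover have "?u \<oplus> a = \<one>" using ac by (simp add: R.minus_eq R.a_assoc R.l_neg)
    ultimately show False using m.one_imp_carrier m.I_notcarr by auto
  qed
  then have u: "inv ?u \<in> carrier R" "inv ?u \<otimes> ?u = \<one>" by auto
  have "x \<ominus>\<^bsub>M\<^esub> a \<odot>\<^bsub>M\<^esub> x = ?u \<odot>\<^bsub>M\<^esub> x"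
    using ac x by (simp add: R.minus_eq M.minus_eq smult_l_distr smult_l_minus)
  then have "inv ?u \<odot>\<^bsub>M\<^esub> (?u \<odot>\<^bsub>M\<^esub> x) \<in> W" using a u submoduleE(4)[OF W] by simp
  then have xW: "x \<in> W" using u uc x by (simp flip: smult_assoc1)
  \<comment> \<open>Now that \<open>x\<close> lies in \<open>W\<close>, the extra summand
    \<open>\<mm>\<close> x of \<open>?D\<close> is absorbed.\<close>
  have "?D \<subseteq> W"
  proof clarify
    fix v b assume v: "v \<in> carrier M" "b \<in> \<mm>" "v \<ominus>\<^bsub>M\<^esub> b \<odot>\<^bsub>M\<^esub> x \<in> W"
    have "v = (v \<ominus>\<^bsub>M\<^esub> b \<odot>\<^bsub>M\<^esub> x) \<oplus>\<^bsub>M\<^esub> b \<odot>\<^bsub>M\<^esub> x"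
      using v mc x by (simp add: M.minus_eq M.a_assoc M.l_neg)
    moreover have "b \<odot>\<^bsub>M\<^esub> x \<in> W" using submoduleE(4)[OF W] xW v mc by blast
    ultimately show "v \<in> W" using v submoduleE(5)[OF W] by metis
  qed
  then have "T \<subseteq> W" using xTD by blast
  then have TK: "T \<subseteq> K" using insert.IH[OF T] unfolding W_def by blast
  have GK: "?G \<subseteq> K" by (rule generated_submodule_minimal[OF K TK])
  have "ideal_smult R M \<mm> ?G \<subseteq> K"
    unfolding ideal_smult_def
    by (rule generated_submodule_minimal[OF K]) (use GK mc submoduleE(4)[OF K] in blast)
  then have "W \<subseteq> K" unfolding W_def by (intro generated_submodule_minimal[OF K]) blast
  then show ?case using xW TK by blast
qed simp


section \<open>The Frobenius endomorphism\<close>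

lemma (in cring) binomial:
  assumes a: "a \<in> carrier R" and b: "b \<in> carrier R"
  shows "(a \<oplus> b) [^] n = (\<Oplus>k\<in>{..n}. add_pow R (n choose k) (a [^] k \<otimes> b [^] (n - k)))"
proof (induction n)
  case (Suc n)
  let ?f = "\<lambda>k. add_pow R (n choose k) (a [^] k \<otimes> b [^] (n - k))"
  let ?g = "\<lambda>k. add_pow R (n choose k) (a [^] k \<otimes> b [^] (Suc n - k))"
  let ?h = "\<lambda>k. add_pow R (Suc n choose k) (a [^] k \<otimes> b [^] (Suc n - k))"
  have c: "add_pow R m (a [^] i \<otimes> b [^] j) \<in> carrier R" for m i j :: nat
    using a b by simp
  have A: "a \<otimes> (a \<oplus> b) [^] n = (\<Oplus>k\<in>{..n}. add_pow R (n choose k) (a [^] Suc k \<otimes> b [^] (n - k)))"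
    unfolding Suc.IH using a b c
    by (subst finsum_rdistr) (auto simp: add_pow_rdistr m_ac nat_pow_Suc2 intro!: add.finprod_cong')
  have "b \<otimes> (a \<oplus> b) [^] n = (\<Oplus>k\<in>{..n}. ?g k)"
    unfolding Suc.IH using a b c
    by (subst finsum_rdistr)
      (auto simp: add_pow_rdistr m_ac Suc_diff_le nat_pow_Suc2 intro!: add.finprod_cong')
  \<comment> \<open>The added top term vanishes because \<open>n choose Suc n\<close> is 0.
    Splitting off the bottom term then shifts the index, so that the sum matches the one in
    \<open>A\<close> term by term.\<close>
  also have "\<dots> = (\<Oplus>k\<in>{..Suc n}. ?g k)"
    using a b c by (subst finsum_Suc) (auto simp: binomial_eq_0)
  also have "\<dots> = (\<Oplus>k\<in>{..n}. ?g (Suc k)) \<oplus> b [^] Suc n"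
    using a b c by (subst finsum_Suc2) auto
  finally have B: "b \<otimes> (a \<oplus> b) [^] n = (\<Oplus>k\<in>{..n}. ?g (Suc k)) \<oplus> b [^] Suc n" .
  have "(a \<oplus> b) [^] Suc n = a \<otimes> (a \<oplus> b) [^] n \<oplus> b \<otimes> (a \<oplus> b) [^] n"
    using a b by (simp add: m_comm[of "(a \<oplus> b) [^] n" "a \<oplus> b"] l_distr)
  also have "\<dots> = (\<Oplus>k\<in>{..n}. add_pow R (n choose k) (a [^] Suc k \<otimes> b [^] (n - k)) \<oplus> ?g (Suc k)) \<oplus> b [^] Suc n"
    unfolding A B using a b c by (subst finsum_addf) (auto simp: a_assoc intro!: finsum_closed)
  \<comment> \<open>Pascal's rule adds the two coefficients, and \<open>b [^] Suc n\<close> is the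
    term at index 0.\<close>
  also have "\<dots> = (\<Oplus>k\<in>{..n}. ?h (Suc k)) \<oplus> ?h 0"
    using a b c by (intro arg_cong2[of _ _ _ _ "(\<oplus>)"] add.finprod_cong') (auto simp: add.nat_pow_mult)
  also have "\<dots> = (\<Oplus>k\<in>{..Suc n}. ?h k)"
    using c by (subst finsum_Suc2) auto
  finally show ?case .
qed simp

lemma (in cring) ring_char_add_pow_eq_zero:
  assumes x: "x \<in> carrier R" and "ring_char R dvd n"
  shows "add_pow R n x = \<zero>"
proof -
  have "add_pow R (ring_char R) \<one> = \<zero>"
    using add.pow_ord_eq_1[of \<one>] by (simp add: ring_char_def)
  then have "add_pow R n \<one> = \<zero>"
    using assms(2) by (auto simp flip: add.nat_pow_pow)
  then show ?thesis using add_pow_ldistr[of \<one> x n] x by simp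
qed

lemma (in cring) freshmans_dream:
  assumes p: "Factorial_Ring.prime (ring_char R)" and a: "a \<in> carrier R" and b: "b \<in> carrier R"
  shows "(a \<oplus> b) [^] ring_char R = a [^] ring_char R \<oplus> b [^] ring_char R"
proof -
  define p where "p = ring_char R"
  \<comment> \<open>Positivity makes 0 and \<open>p\<close> distinct, so that the sum over
    \<open>{0, p}\<close> has two terms.\<close>
  have p0: "p > 0" using p prime_gt_0_nat unfolding p_def by blast
  let ?f = "\<lambda>k. add_pow R (p choose k) (a [^] k \<otimes> b [^] (p - k))"
  have c: "?f k \<in> carrier R" for k using a b by simp
  \<comment> \<open>A prime divides its middle binomial coefficients, so these terms are multiples
    of the characteristic.\<close>
  have z: "?f k = \<zero>" if "k \<in> {..p} - {0, p}" for k
    using that p a b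
    by (intro ring_char_add_pow_eq_zero) (auto simp: p_def[symmetric] intro!: dvd_choose_prime)
  have "(a \<oplus> b) [^] p = (\<Oplus>k\<in>{..p}. ?f k)" by (rule binomial[OF a b])
  also have "\<dots> = (\<Oplus>k\<in>{0, p}. ?f k)"
    using c z by (intro add.finprod_mono_neutral_cong_right) auto
  also have "\<dots> = a [^] p \<oplus> b [^] p"
    using p0 a b c by (simp add: a_comm)
  finally show ?thesis unfolding p_def .
qed

lemma (in cring) frobenius_ring_hom:
  assumes "Factorial_Ring.prime (ring_char R)"
  shows "frobenius R (ring_char R) \<in> ring_hom R R"
  unfolding frobenius_def using assms
  by (intro ring_hom_memI) (auto simp: nat_pow_distrib freshmans_dream)

lemma (in cring) frobenius_funpow_ring_hom:
  assumes "Factorial_Ring.prime (ring_char R)"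
  shows "frobenius R (ring_char R) ^^ e \<in> ring_hom R R"
proof (induction e)
  case 0
  show ?case by (intro ring_hom_memI) auto
next
  case (Suc e)
  from ring_hom_trans[OF Suc frobenius_ring_hom[OF assms]] show ?case by (simp add: comp_def)
qed


section \<open>Base change\<close>

text \<open>The last two claims are the two families of defining relations read modulo the kernel:
  each relation is a difference lying in the kernel, so its two sides have the same coset.\<close>

lemma
  assumes M: "Module.module R M" and S: "cring S" and \<phi>: "\<phi> \<in> ring_hom R S"
  defines "B \<equiv> base_change S \<phi> R M"
  shows base_change_unit_closed: "x \<in> carrier M \<Longrightarrow> base_change_unit S \<phi> R M x \<in> carrier B"
    and base_change_unit_add: "x \<in> carrier M \<Longrightarrow> y \<in> carrier M \<Longrightarrow>
      base_change_unit S \<phi> R M (x \<oplus>\<^bsub>M\<^esub> y) =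
        base_change_unit S \<phi> R M x \<oplus>\<^bsub>B\<^esub> base_change_unit S \<phi> R M y"
    and base_change_unit_smult: "a \<in> carrier R \<Longrightarrow> x \<in> carrier M \<Longrightarrow>
      base_change_unit S \<phi> R M (a \<odot>\<^bsub>M\<^esub> x) = \<phi> a \<odot>\<^bsub>B\<^esub> base_change_unit S \<phi> R M x"
proof -
  interpret M: Module.module R M by fact
  let ?F = "free_module S (carrier M)"
  let ?K = "base_change_kernel S \<phi> R M"
  interpret F: Module.module S ?F using free_module_is_module S by blast
  have K: "submodule ?K S ?F" unfolding base_change_kernel_def
    by (intro F.generated_submodule_is_submodule base_change_relations_carrier assms)
  note q = quotient_module_is_module[OF F.module_axioms K, folded base_change_def, folded B_def]
  note gen[simp] = free_gen_carrier[OF S, of _ "carrier M"]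
  note [simp] = ring_hom_closed[OF \<phi>]
  have rel: "base_change_relations S \<phi> R M \<subseteq> ?K"
    unfolding base_change_kernel_def by (rule generated_submodule_incl)
  have coset: "?K +>\<^bsub>?F\<^esub> u = ?K +>\<^bsub>?F\<^esub> v"
    if "u \<ominus>\<^bsub>?F\<^esub> v \<in> ?K" "u \<in> carrier ?F" "v \<in> carrier ?F" for u v
  proof (rule F.M.a_repr_independence[symmetric])
    have "u = (u \<ominus>\<^bsub>?F\<^esub> v) \<oplus>\<^bsub>?F\<^esub> v" using that by (simp add: F.M.minus_eq F.M.a_assoc F.M.l_neg)
    then show "u \<in> ?K +>\<^bsub>?F\<^esub> v" using that(1) by (auto simp: a_r_coset_def')
  qed (use that submodule.axioms(1)[OF K] in auto)
  show "base_change_unit S \<phi> R M x \<in> carrier B" if "x \<in> carrier M"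
    using that gen
    by (auto simp: B_def base_change_def quotient_module_def A_RCOSETS_def' base_change_unit_def)
  show "base_change_unit S \<phi> R M (x \<oplus>\<^bsub>M\<^esub> y) =
      base_change_unit S \<phi> R M x \<oplus>\<^bsub>B\<^esub> base_change_unit S \<phi> R M y"
    if "x \<in> carrier M" "y \<in> carrier M"
    unfolding base_change_unit_def q(2)[OF gen[OF that(1)] gen[OF that(2)]]
    by (rule coset) (use that rel in \<open>auto simp: base_change_relations_def Let_def\<close>)
  show "base_change_unit S \<phi> R M (a \<odot>\<^bsub>M\<^esub> x) = \<phi> a \<odot>\<^bsub>B\<^esub> base_change_unit S \<phi> R M x"
    if "a \<in> carrier R" "x \<in> carrier M"
    unfolding base_change_unit_def q(3)[OF ring_hom_closed[OF \<phi> that(1)] gen[OF that(2)]]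
    by (rule coset) (use that rel in \<open>auto simp: base_change_relations_def Let_def\<close>)
qed

text \<open>Used with Frobenius as \<open>\<psi>\<close>: on the twisted module a
  Frobenius-semilinear map becomes linear, as the universal property of base change
  requires.\<close>

lemma restriction_of_scalars_module:
  assumes "Module.module S P" and R: "cring R" and \<psi>: "\<psi> \<in> ring_hom R S"
  shows "Module.module R (P\<lparr>smult := \<lambda>a x. \<psi> a \<odot>\<^bsub>P\<^esub> x\<rparr>)"
proof -
  interpret P: Module.module S P by fact
  have "abelian_group (P\<lparr>smult := \<lambda>a x. \<psi> a \<odot>\<^bsub>P\<^esub> x\<rparr>)"
  proof (rule abelian_groupI)
    fix x assume "x \<in> carrier (P\<lparr>smult := \<lambda>a x. \<psi> a \<odot>\<^bsub>P\<^esub> x\<rparr>)"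
    then show "\<exists>y\<in>carrier (P\<lparr>smult := \<lambda>a x. \<psi> a \<odot>\<^bsub>P\<^esub> x\<rparr>).
        y \<oplus>\<^bsub>P\<lparr>smult := \<lambda>a x. \<psi> a \<odot>\<^bsub>P\<^esub> x\<rparr>\<^esub> x = \<zero>\<^bsub>P\<lparr>smult := \<lambda>a x. \<psi> a \<odot>\<^bsub>P\<^esub> x\<rparr>\<^esub>"
      by (intro bexI[of _ "\<ominus>\<^bsub>P\<^esub> x"]) (auto simp: P.M.l_neg)
  qed (auto simp: P.M.a_ac)
  then show ?thesis
    by (intro moduleI R)
      (auto simp: ring_hom_closed[OF \<psi>] ring_hom_add[OF \<psi>] ring_hom_mult[OF \<psi>] ring_hom_one[OF \<psi>]
        P.smult_l_distr P.smult_r_distr P.smult_assoc1)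
qed


section \<open>Frobenius closures as limits\<close>

locale prime_characteristic_module = module +
  fixes p :: nat
  assumes prime_p: "Factorial_Ring.prime p" and ring_char_p: "ring_char R = p"
begin

abbreviation frob_module (\<open>\<F>\<close>) where "\<F> e \<equiv> frobenius_module R p e M"
abbreviation frob_pow (\<open>\<p>\<close>) where "\<p> e \<equiv> frobenius_power R p e M"
abbreviation bracket (\<open>\<B>\<close>) where "\<B> e \<equiv> bracket_power R p e M"

lemma frobenius_hom: "frobenius R p \<in> ring_hom R R"
  and frobenius_funpow_hom: "frobenius R p ^^ e \<in> ring_hom R R"
  using R.frobenius_ring_hom R.frobenius_funpow_ring_hom prime_p ring_char_p by auto

lemma frobenius_module_is_module: "Module.module R (\<F> e)"
  unfolding frobenius_module_def
  by (rule base_change_is_module[OF module_axioms R.is_cring frobenius_funpow_hom])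

lemma frobenius_power_closed: "x \<in> carrier M \<Longrightarrow> \<p> e x \<in> carrier (\<F> e)"
  and frobenius_power_add: "x \<in> carrier M \<Longrightarrow> y \<in> carrier M \<Longrightarrow>
    \<p> e (x \<oplus>\<^bsub>M\<^esub> y) = \<p> e x \<oplus>\<^bsub>\<F> e\<^esub> \<p> e y"
  and frobenius_power_smult: "a \<in> carrier R \<Longrightarrow> x \<in> carrier M \<Longrightarrow>
    \<p> e (a \<odot>\<^bsub>M\<^esub> x) = (frobenius R p ^^ e) a \<odot>\<^bsub>\<F> e\<^esub> \<p> e x"
  unfolding frobenius_module_def frobenius_power_def
  by (rule base_change_unit_closed base_change_unit_add base_change_unit_smult,
    (rule module_axioms R.is_cring frobenius_funpow_hom | assumption)+)+

lemma submodule_frobenius_power_preimage: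
  assumes "submodule K R (\<F> e)"
  shows "submodule {x \<in> carrier M. \<p> e x \<in> K} R M"
  by (rule submodule_semilinear_preimage[OF module_axioms frobenius_module_is_module _ _ _ _ assms,
        where \<phi> = "frobenius R p ^^ e"])
    (auto simp: frobenius_power_closed frobenius_power_add frobenius_power_smult
      ring_hom_closed[OF frobenius_funpow_hom])

section \<open>Transition maps between the Frobenius base changes\<close>

text \<open>The map \<open>\<p> (Suc e)\<close> is semilinear along the \<open>e\<close>-th iterate
  of Frobenius once scalars on \<open>\<F> (Suc e)\<close> act through one further Frobenius, since
  the two compose to the iterate \<open>Suc e\<close>. It thus factors through
  \<open>\<F> e\<close>, and linearity into the twisted module is Frobenius-semilinearity into the
  original one.\<close>

lemma frobenius_transition_exists:
  "\<exists>\<theta>. \<theta> \<in> carrier (\<F> e) \<rightarrow> carrier (\<F> (Suc e)) \<and>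
    (\<forall>X\<in>carrier (\<F> e). \<forall>Y\<in>carrier (\<F> e). \<theta> (X \<oplus>\<^bsub>\<F> e\<^esub> Y) = \<theta> X \<oplus>\<^bsub>\<F> (Suc e)\<^esub> \<theta> Y) \<and>
    (\<forall>a\<in>carrier R. \<forall>X\<in>carrier (\<F> e). \<theta> (a \<odot>\<^bsub>\<F> e\<^esub> X) = frobenius R p a \<odot>\<^bsub>\<F> (Suc e)\<^esub> \<theta> X) \<and>
    (\<forall>x\<in>carrier M. \<theta> (\<p> e x) = \<p> (Suc e) x)"
proof -
  let ?P = "(\<F> (Suc e))\<lparr>smult := \<lambda>a x. frobenius R p a \<odot>\<^bsub>\<F> (Suc e)\<^esub> x\<rparr>"
  have P: "Module.module R ?P"
    by (rule restriction_of_scalars_module[OF frobenius_module_is_module R.is_cring frobenius_hom])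
  have "\<p> (Suc e) \<in> carrier M \<rightarrow> carrier ?P" using frobenius_power_closed by simp
  from base_change_universal[OF module_axioms R.is_cring frobenius_funpow_hom[of e] P this]
  obtain \<theta> where "\<theta> \<in> carrier (\<F> e) \<rightarrow>\<^sub>E carrier ?P"
    "\<forall>X\<in>carrier (\<F> e). \<forall>Y\<in>carrier (\<F> e). \<theta> (X \<oplus>\<^bsub>\<F> e\<^esub> Y) = \<theta> X \<oplus>\<^bsub>?P\<^esub> \<theta> Y"
    "\<forall>a\<in>carrier R. \<forall>X\<in>carrier (\<F> e). \<theta> (a \<odot>\<^bsub>\<F> e\<^esub> X) = a \<odot>\<^bsub>?P\<^esub> \<theta> X"
    "\<forall>x\<in>carrier M. \<theta> (\<p> e x) = \<p> (Suc e) x"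
    using frobenius_power_add[of _ _ "Suc e"] frobenius_power_smult[of _ _ "Suc e"]
    unfolding frobenius_module_def frobenius_power_def by (auto elim!: ex1E)
  then show ?thesis by (intro exI[of _ \<theta>]) (auto simp: PiE_def)
qed

text \<open>This is the map taking s \<otimes> x to s^p \<otimes> x. The universal property
  determines it on the carrier, so the choice affects only values outside.\<close>

definition transition :: "nat \<Rightarrow> ('c \<Rightarrow> 'a) set \<Rightarrow> ('c \<Rightarrow> 'a) set" where
  "transition e = (SOME \<theta>. \<theta> \<in> carrier (\<F> e) \<rightarrow> carrier (\<F> (Suc e)) \<and>
    (\<forall>X\<in>carrier (\<F> e). \<forall>Y\<in>carrier (\<F> e). \<theta> (X \<oplus>\<^bsub>\<F> e\<^esub> Y) = \<theta> X \<oplus>\<^bsub>\<F> (Suc e)\<^esub> \<theta> Y) \<and>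
    (\<forall>a\<in>carrier R. \<forall>X\<in>carrier (\<F> e). \<theta> (a \<odot>\<^bsub>\<F> e\<^esub> X) = frobenius R p a \<odot>\<^bsub>\<F> (Suc e)\<^esub> \<theta> X) \<and>
    (\<forall>x\<in>carrier M. \<theta> (\<p> e x) = \<p> (Suc e) x))"

lemma transition_closed: "X \<in> carrier (\<F> e) \<Longrightarrow> transition e X \<in> carrier (\<F> (Suc e))"
  and transition_add: "X \<in> carrier (\<F> e) \<Longrightarrow> Y \<in> carrier (\<F> e) \<Longrightarrow>
    transition e (X \<oplus>\<^bsub>\<F> e\<^esub> Y) = transition e X \<oplus>\<^bsub>\<F> (Suc e)\<^esub> transition e Y"
  and transition_smult: "a \<in> carrier R \<Longrightarrow> X \<in> carrier (\<F> e) \<Longrightarrow>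
    transition e (a \<odot>\<^bsub>\<F> e\<^esub> X) = frobenius R p a \<odot>\<^bsub>\<F> (Suc e)\<^esub> transition e X"
  and transition_frobenius_power: "x \<in> carrier M \<Longrightarrow> transition e (\<p> e x) = \<p> (Suc e) x"
  using someI_ex[OF frobenius_transition_exists[of e], folded transition_def] by auto

primrec transition_iter :: "nat \<Rightarrow> nat \<Rightarrow> ('c \<Rightarrow> 'a) set \<Rightarrow> ('c \<Rightarrow> 'a) set" where
  "transition_iter e 0 X = X"
| "transition_iter e (Suc d) X = transition (e + d) (transition_iter e d X)"

lemma transition_iter_closed:
  "X \<in> carrier (\<F> e) \<Longrightarrow> transition_iter e d X \<in> carrier (\<F> (e + d))"
  by (induction d) (simp_all add: transition_closed)

lemma transition_iter_add:
  "X \<in> carrier (\<F> e) \<Longrightarrow> Y \<in> carrier (\<F> e) \<Longrightarrow> transition_iter e d (X \<oplus>\<^bsub>\<F> e\<^esub> Y) =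
    transition_iter e d X \<oplus>\<^bsub>\<F> (e + d)\<^esub> transition_iter e d Y"
  by (induction d) (simp_all add: transition_add transition_iter_closed)

lemma transition_iter_smult:
  "a \<in> carrier R \<Longrightarrow> X \<in> carrier (\<F> e) \<Longrightarrow> transition_iter e d (a \<odot>\<^bsub>\<F> e\<^esub> X) =
    (frobenius R p ^^ d) a \<odot>\<^bsub>\<F> (e + d)\<^esub> transition_iter e d X"
  by (induction d)
    (simp_all add: transition_smult transition_iter_closed ring_hom_closed[OF frobenius_funpow_hom])

lemma transition_iter_frobenius_power:
  "x \<in> carrier M \<Longrightarrow> transition_iter e d (\<p> e x) = \<p> (e + d) x"
  by (induction d) (simp_all add: transition_frobenius_power)

section \<open>Stable families of submodules and their limits\<close>

definition transition_stable :: "(nat \<Rightarrow> ('c \<Rightarrow> 'a) set set) \<Rightarrow> bool" where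
  "transition_stable K \<longleftrightarrow>
    (\<forall>e. submodule (K e) R (\<F> e) \<and> (\<forall>X\<in>K e. transition e X \<in> K (Suc e)))"

definition power_limit :: "(nat \<Rightarrow> ('c \<Rightarrow> 'a) set set) \<Rightarrow> 'c set" where
  "power_limit K = {z \<in> carrier M. \<exists>e. \<p> e z \<in> K e}"

text \<open>These are the elements whose image in the direct limit of the groups
  \<open>\<F> e\<close>, for stable \<open>K\<close>, lies in the direct limit of the
  \<open>K e\<close>.\<close>

definition eventual_submodule :: "(nat \<Rightarrow> ('c \<Rightarrow> 'a) set set) \<Rightarrow> nat \<Rightarrow> ('c \<Rightarrow> 'a) set set" where
  "eventual_submodule K e = {X \<in> carrier (\<F> e). \<exists>d. transition_iter e d X \<in> K (e + d)}"

text \<open>A transition is only semilinear, yet the preimage of a submodule is a submodule. It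
  contains the generators and hence their span.\<close>

lemma transition_stable_generated:
  assumes S: "\<And>e. S e \<subseteq> carrier (\<F> e)"
    and step: "\<And>e X. X \<in> S e \<Longrightarrow> transition e X \<in> generated_submodule R (\<F> (Suc e)) (S (Suc e))"
  shows "transition_stable (\<lambda>e. generated_submodule R (\<F> e) (S e))"
  unfolding transition_stable_def
proof (intro allI conjI ballI)
  fix e
  have sub: "submodule (generated_submodule R (\<F> e) (S e)) R (\<F> e)" for e
    by (rule module.generated_submodule_is_submodule[OF frobenius_module_is_module S])
  then show "submodule (generated_submodule R (\<F> e) (S e)) R (\<F> e)" .
  let ?H = "{X \<in> carrier (\<F> e). transition e X \<in> generated_submodule R (\<F> (Suc e)) (S (Suc e))}"
  have "submodule ?H R (\<F> e)"
    by (rule submodule_semilinear_preimage[OF frobenius_module_is_module frobenius_module_is_module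
          _ _ _ _ sub, where \<phi> = "frobenius R p"])
      (auto simp: transition_closed transition_add transition_smult ring_hom_closed[OF frobenius_hom])
  then have "generated_submodule R (\<F> e) (S e) \<subseteq> ?H"
    by (rule generated_submodule_minimal) (use S[of e] step in blast)
  then show "transition e X \<in> generated_submodule R (\<F> (Suc e)) (S (Suc e))"
    if "X \<in> generated_submodule R (\<F> e) (S e)" for X using that by blast
qed

lemma transition_stable_iter_mono:
  assumes "transition_stable K" "transition_iter e d X \<in> K (e + d)" "d \<le> d'"
  shows "transition_iter e d' X \<in> K (e + d')"
  using assms(3)
proof (induction d' rule: dec_induct)
  case (step n)
  then show ?case using assms(1) by (simp add: transition_stable_def)
qed (rule assms(2))

lemma frobenius_power_mem_mono:
  assumes "transition_stable K" "\<p> e x \<in> K e" "x \<in> carrier M" "e \<le> e'"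
  shows "\<p> e' x \<in> K e'"
  using transition_stable_iter_mono[OF assms(1), of e 0 "\<p> e x" "e' - e"] assms(2-)
  by (simp add: transition_iter_frobenius_power)

text \<open>The set is the union over \<open>d\<close> of the preimages \<open>H d\<close> of
  \<open>K (e + d)\<close>. Stability makes this union increasing, so two elements lie in a common
  \<open>H d\<close> and can be added there.\<close>

lemma eventual_submodule_is_submodule:
  assumes K: "transition_stable K"
  shows "submodule (eventual_submodule K e) R (\<F> e)"
proof -
  interpret F: Module.module R "\<F> e" by (rule frobenius_module_is_module)
  have Kd: "submodule (K d) R (\<F> d)" for d using K by (simp add: transition_stable_def)
  define H where "H d = {X \<in> carrier (\<F> e). transition_iter e d X \<in> K (e + d)}" for d
  have H: "submodule (H d) R (\<F> e)" for d
    unfolding H_def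
    by (rule submodule_semilinear_preimage[OF frobenius_module_is_module frobenius_module_is_module
          _ _ _ _ Kd, where \<phi> = "frobenius R p ^^ d"])
      (auto simp: transition_iter_closed transition_iter_add transition_iter_smult
        ring_hom_closed[OF frobenius_funpow_hom])
  have mono: "H d \<subseteq> H d'" if "d \<le> d'" for d d'
    unfolding H_def using transition_stable_iter_mono[OF K _ that] by blast
  have eq: "eventual_submodule K e = (\<Union>d. H d)"
    unfolding eventual_submodule_def H_def by blast
  note H' = F.submoduleE[OF H]
  show ?thesis
    unfolding eq
  proof (rule F.submoduleI)
    fix X Y assume "X \<in> (\<Union>d. H d)" "Y \<in> (\<Union>d. H d)"
    then obtain d d' where "X \<in> H d" "Y \<in> H d'" by blast
    then have "X \<in> H (max d d')" "Y \<in> H (max d d')"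
      using mono[of d "max d d'"] mono[of d' "max d d'"] by auto
    then show "X \<oplus>\<^bsub>\<F> e\<^esub> Y \<in> (\<Union>d. H d)" using H'(5) by blast
  next
    show "(\<Union>d. H d) \<subseteq> carrier (\<F> e)" using H'(1) by blast
    show "\<zero>\<^bsub>\<F> e\<^esub> \<in> (\<Union>d. H d)" using F.submodule_zero_closed[OF H] by blast
    show "\<ominus>\<^bsub>\<F> e\<^esub> X \<in> (\<Union>d. H d)" if "X \<in> (\<Union>d. H d)" for X
      using that H'(3) by auto
    show "a \<odot>\<^bsub>\<F> e\<^esub> X \<in> (\<Union>d. H d)" if "a \<in> carrier R" "X \<in> (\<Union>d. H d)" for a X
      using that H'(4) by auto
  qed
qed

text \<open>The exponent \<open>e\<close> on the right is arbitrary and independent of the one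
  witnessing the left side. Inclusions inside any single \<open>\<F> e\<close> thereby yield
  membership in the limit.\<close>

lemma power_limit_iff_eventual:
  assumes K: "transition_stable K" and z: "z \<in> carrier M"
  shows "z \<in> power_limit K \<longleftrightarrow> \<p> e z \<in> eventual_submodule K e"
proof
  assume "z \<in> power_limit K"
  then obtain e' where "\<p> e' z \<in> K e'" unfolding power_limit_def by blast
  \<comment> \<open>The exponent \<open>e + e'\<close> is above \<open>e'\<close>, so stability
    applies, and it is reached from \<open>e\<close> by \<open>e'\<close> transitions.\<close>
  then have "\<p> (e + e') z \<in> K (e + e')" using frobenius_power_mem_mono[OF K] z by simp
  then show "\<p> e z \<in> eventual_submodule K e"
    using z unfolding eventual_submodule_def
    by (auto simp: frobenius_power_closed transition_iter_frobenius_power)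
next
  assume "\<p> e z \<in> eventual_submodule K e"
  then show "z \<in> power_limit K"
    using z unfolding eventual_submodule_def power_limit_def
    by (auto simp: transition_iter_frobenius_power)
qed

lemma power_limit_is_submodule:
  assumes "transition_stable K"
  shows "submodule (power_limit K) R M"
proof -
  \<comment> \<open>Testing at exponent 0 presents the limit as the preimage of one submodule under
    one semilinear map.\<close>
  have "power_limit K = {z \<in> carrier M. \<p> 0 z \<in> eventual_submodule K 0}"
    using power_limit_iff_eventual[OF assms, of _ 0] unfolding power_limit_def by blast
  then show ?thesis
    using submodule_frobenius_power_preimage[OF eventual_submodule_is_submodule[OF assms]] by simp
qed

lemma power_limit_mono: "(\<And>e. K e \<subseteq> K' e) \<Longrightarrow> power_limit K \<subseteq> power_limit K'"
  unfolding power_limit_def by blast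

section \<open>Bracket powers and their multiples by an ideal\<close>

lemma bracket_power_incl: "x \<in> N \<Longrightarrow> \<p> e x \<in> \<B> e N"
  unfolding bracket_power_def using generated_submodule_incl[of "\<p> e ` N" R "\<F> e"] by blast

lemma bracket_power_mono: "L \<subseteq> N \<Longrightarrow> \<B> e L \<subseteq> \<B> e N"
  unfolding bracket_power_def by (intro generated_submodule_mono image_mono)

lemma bracket_power_stable: "N \<subseteq> carrier M \<Longrightarrow> transition_stable (\<lambda>e. \<B> e N)"
  unfolding bracket_power_def
  by (rule transition_stable_generated)
    (auto simp: frobenius_power_closed transition_frobenius_power subset_iff
      intro!: subsetD[OF generated_submodule_incl])

lemma bracket_power_is_submodule: "N \<subseteq> carrier M \<Longrightarrow> submodule (\<B> e N) R (\<F> e)"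
  using bracket_power_stable by (simp add: transition_stable_def)

text \<open>It suffices to treat the generators \<open>\<p> e x\<close> with
  \<open>x \<in> N\<close>. Each may need its own number of transitions; linear combinations are
  covered because the right side is a submodule.\<close>

lemma bracket_power_subset_eventual:
  assumes K: "transition_stable K" and "N \<subseteq> power_limit K"
  shows "\<B> e N \<subseteq> eventual_submodule K e"
  unfolding bracket_power_def
  by (rule generated_submodule_minimal[OF eventual_submodule_is_submodule[OF K]])
    (use power_limit_iff_eventual[OF K] assms(2) in \<open>auto simp: power_limit_def\<close>)

text \<open>As \<open>p\<close> is positive, a^p has a factor \<open>a\<close>. This keeps scalars
  in the ideal when transitions raise them to powers of \<open>p\<close>.\<close>

lemma frobenius_funpow_ideal:
  assumes "ideal I R" "a \<in> I"
  shows "(frobenius R p ^^ d) a \<in> I"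
proof (induction d)
  case (Suc d)
  interpret I: ideal I R by fact
  obtain k where "p = Suc k" using prime_gt_0_nat[OF prime_p] gr0_implies_Suc by blast
  then show ?case using Suc I.Icarr by (simp add: frobenius_def I.I_l_closed)
qed (use assms in simp)

lemma ideal_smult_bracket_power_stable:
  assumes I: "ideal I R" and N: "N \<subseteq> carrier M"
  shows "transition_stable (\<lambda>e. ideal_smult R (\<F> e) I (\<B> e N))"
  unfolding ideal_smult_def
proof (rule transition_stable_generated)
  note Ic = ideal.Icarr[OF I]
  have Bc: "\<B> e N \<subseteq> carrier (\<F> e)" for e
    using module.submoduleE(1)[OF frobenius_module_is_module bracket_power_is_submodule[OF N]] .
  fix e
  show "{a \<odot>\<^bsub>\<F> e\<^esub> x |a x. a \<in> I \<and> x \<in> \<B> e N} \<subseteq> carrier (\<F> e)"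
    using Ic Bc[of e] module.smult_closed[OF frobenius_module_is_module] by blast
  fix X assume "X \<in> {a \<odot>\<^bsub>\<F> e\<^esub> x |a x. a \<in> I \<and> x \<in> \<B> e N}"
  then obtain a x where X: "X = a \<odot>\<^bsub>\<F> e\<^esub> x" "a \<in> I" "x \<in> \<B> e N" by blast
  then have "transition e X = frobenius R p a \<odot>\<^bsub>\<F> (Suc e)\<^esub> transition e x"
    using transition_smult[of a x e] Ic subsetD[OF Bc] by simp
  moreover have "frobenius R p a \<in> I" using frobenius_funpow_ideal[OF I X(2), of 1] by simp
  moreover have "transition e x \<in> \<B> (Suc e) N"
    using bracket_power_stable[OF N] X(3) by (simp add: transition_stable_def)
  ultimately have "transition e X \<in> {a \<odot>\<^bsub>\<F> (Suc e)\<^esub> x |a x. a \<in> I \<and> x \<in> \<B> (Suc e) N}" by blast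
  then show "transition e X \<in> generated_submodule R (\<F> (Suc e))
      {a \<odot>\<^bsub>\<F> (Suc e)\<^esub> x |a x. a \<in> I \<and> x \<in> \<B> (Suc e) N}"
    by (rule subsetD[OF generated_submodule_incl])
qed

lemma frobenius_closure_eq_limit: "frobenius_closure R p M N = power_limit (\<lambda>e. \<B> e N)"
  and special_frobenius_closure_eq_limit:
    "special_frobenius_closure R I p M N = power_limit (\<lambda>e. ideal_smult R (\<F> e) I (\<B> e N))"
  by (simp_all add: frobenius_closure_def special_frobenius_closure_def power_limit_def)

lemma subset_frobenius_closure: "N \<subseteq> carrier M \<Longrightarrow> N \<subseteq> frobenius_closure R p M N"
  unfolding frobenius_closure_def using bracket_power_incl by blast

section \<open>Parts (1) to (3), for an arbitrary ideal \<open>I\<close>\<close>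

context
  fixes I L assumes I: "ideal I R" and L: "submodule L R M"
begin

lemma special_frobenius_closure_is_submodule:
  "submodule (special_frobenius_closure R I p M L) R M"
  unfolding special_frobenius_closure_eq_limit
  by (intro power_limit_is_submodule ideal_smult_bracket_power_stable I submoduleE(1)[OF L])

lemma ideal_smult_subset_special_frobenius_closure:
  "ideal_smult R M I L \<subseteq> special_frobenius_closure R I p M L"
  unfolding ideal_smult_def[of R M]
proof (rule generated_submodule_minimal[OF special_frobenius_closure_is_submodule], clarify)
  fix a x assume ax: "a \<in> I" "x \<in> L"
  then have "a \<in> carrier R" "x \<in> carrier M"
    using additive_subgroup.a_subset[OF ideal.axioms(1)[OF I]] submoduleE(1)[OF L] by auto
  \<comment> \<open>Exponent 0 serves as the witness: the zeroth iterate of Frobenius is the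
    identity, so the scalar \<open>a\<close> stays unchanged.\<close>
  moreover from this have "\<p> 0 (a \<odot>\<^bsub>M\<^esub> x) = a \<odot>\<^bsub>\<F> 0\<^esub> \<p> 0 x"
    by (simp add: frobenius_power_smult)
  ultimately show "a \<odot>\<^bsub>M\<^esub> x \<in> special_frobenius_closure R I p M L"
    unfolding special_frobenius_closure_def
    using ideal_smult_incl[OF ax(1) bracket_power_incl[OF ax(2)], of "\<F> 0" 0]
    by (auto intro!: exI[of _ 0])
qed

lemma special_subset_frobenius_closure:
  "special_frobenius_closure R I p M L \<subseteq> frobenius_closure R p M L"
  unfolding special_frobenius_closure_eq_limit frobenius_closure_eq_limit
  by (intro power_limit_mono ideal_smult_subset bracket_power_is_submodule
      submoduleE(1)[OF L] additive_subgroup.a_subset[OF ideal.axioms(1)[OF I]])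

text \<open>An element of a bracket power of the closure reaches the bracket power of
  \<open>L\<close> after some \<open>d\<close> transitions, and a multiplier from \<open>I\<close>
  meanwhile becomes another element of \<open>I\<close>. The converse is monotonicity applied to the
  inclusion of \<open>L\<close> in its closure.\<close>

lemma special_of_frobenius_closure:
  "special_frobenius_closure R I p M (frobenius_closure R p M L) = special_frobenius_closure R I p M L"
proof
  let ?K = "\<lambda>e. \<B> e L" and ?J = "\<lambda>e. ideal_smult R (\<F> e) I (\<B> e L)"
  have K: "transition_stable ?K" and J: "transition_stable ?J"
    using bracket_power_stable ideal_smult_bracket_power_stable I submoduleE(1)[OF L] by auto
  have "ideal_smult R (\<F> e) I (\<B> e (frobenius_closure R p M L)) \<subseteq> eventual_submodule ?J e" for e
    unfolding ideal_smult_def[of R "\<F> e" I "\<B> e (frobenius_closure R p M L)"]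
  proof (rule generated_submodule_minimal[OF eventual_submodule_is_submodule[OF J]], clarify)
    fix a X assume a: "a \<in> I" and "X \<in> \<B> e (frobenius_closure R p M L)"
    then have "X \<in> eventual_submodule ?K e"
      using bracket_power_subset_eventual[OF K] by (auto simp: frobenius_closure_eq_limit)
    then obtain d where X: "X \<in> carrier (\<F> e)" "transition_iter e d X \<in> \<B> (e + d) L"
      unfolding eventual_submodule_def by blast
    have ac: "a \<in> carrier R" using a additive_subgroup.a_subset[OF ideal.axioms(1)[OF I]] by blast
    have "transition_iter e d (a \<odot>\<^bsub>\<F> e\<^esub> X) \<in> ?J (e + d)"
      unfolding transition_iter_smult[OF ac X(1)]
      by (rule ideal_smult_incl[OF frobenius_funpow_ideal[OF I a] X(2)])
    then show "a \<odot>\<^bsub>\<F> e\<^esub> X \<in> eventual_submodule ?J e"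
      unfolding eventual_submodule_def
      using module.smult_closed[OF frobenius_module_is_module ac X(1)] by blast
  qed
  then show "special_frobenius_closure R I p M (frobenius_closure R p M L)
      \<subseteq> special_frobenius_closure R I p M L"
    unfolding special_frobenius_closure_eq_limit
    using power_limit_iff_eventual[OF J] unfolding power_limit_def by blast
  show "special_frobenius_closure R I p M L
      \<subseteq> special_frobenius_closure R I p M (frobenius_closure R p M L)"
    unfolding special_frobenius_closure_eq_limit
    by (intro power_limit_mono ideal_smult_mono bracket_power_mono subset_frobenius_closure
        submoduleE(1)[OF L])
qed

text \<open>The special part is the limit of \<open>?J\<close>, and the bracket powers of a limit
  are eventually mapped into the family itself. Hence taking the closure adds nothing.\<close>

lemma frobenius_closure_of_special:
  "frobenius_closure R p M (special_frobenius_closure R I p M L) = special_frobenius_closure R I p M L"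
proof
  let ?J = "\<lambda>e. ideal_smult R (\<F> e) I (\<B> e L)"
  have J: "transition_stable ?J"
    by (rule ideal_smult_bracket_power_stable[OF I submoduleE(1)[OF L]])
  have "\<B> e (power_limit ?J) \<subseteq> eventual_submodule ?J e" for e
    by (rule bracket_power_subset_eventual[OF J]) simp
  then show "frobenius_closure R p M (special_frobenius_closure R I p M L)
      \<subseteq> special_frobenius_closure R I p M L"
    unfolding special_frobenius_closure_eq_limit frobenius_closure_def
    using power_limit_iff_eventual[OF J] by blast
  show "special_frobenius_closure R I p M L
      \<subseteq> frobenius_closure R p M (special_frobenius_closure R I p M L)"
    by (rule subset_frobenius_closure)
      (rule submoduleE(1)[OF special_frobenius_closure_is_submodule])
qed

end

section \<open>Part (4)\<close>

lemma frobenius_closure_nakayama: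
  assumes noeth: "noetherian_ring R" and loc: "local_ring \<mm> R"
    and fg: "finitely_generated_module R M"
    and L: "submodule L R M" and N: "submodule N R M"
    and sub: "N \<subseteq> frobenius_closure R p M (L <+>\<^bsub>M\<^esub> special_frobenius_closure R \<mm> p M N)"
  shows "N \<subseteq> frobenius_closure R p M L"
proof -
  interpret m: local_ring \<mm> R by fact
  note Lc = submoduleE(1)[OF L] and Nc = submoduleE(1)[OF N] and mI = m.is_ideal
  let ?J = "\<lambda>e. ideal_smult R (\<F> e) \<mm> (\<B> e N)"
  define G where "G e = generated_submodule R (\<F> e) (\<B> e L \<union> ?J e)" for e
  have GB: "\<B> e L \<subseteq> G e" and GJ: "?J e \<subseteq> G e" for e
    using generated_submodule_incl[of "\<B> e L \<union> ?J e" R "\<F> e"] unfolding G_def by auto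
  have BL: "transition_stable (\<lambda>e. \<B> e L)" and J: "transition_stable ?J"
    by (rule bracket_power_stable[OF Lc], rule ideal_smult_bracket_power_stable[OF mI Nc])
  have G: "transition_stable G"
    unfolding G_def
  proof (rule transition_stable_generated)
    fix e
    show "\<B> e L \<union> ?J e \<subseteq> carrier (\<F> e)"
      using BL J module.submoduleE(1)[OF frobenius_module_is_module]
      unfolding transition_stable_def by blast
    show "transition e X \<in> generated_submodule R (\<F> (Suc e)) (\<B> (Suc e) L \<union> ?J (Suc e))"
      if "X \<in> \<B> e L \<union> ?J e" for X
      using that BL J GB[of "Suc e"] GJ[of "Suc e"]
      unfolding transition_stable_def G_def by blast
  qed
  \<comment> \<open>Both summands lie in the limit of \<open>G\<close>, each through one summand of
    \<open>G e\<close>; since the limit is a submodule, it contains their sum.\<close>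
  have "L \<subseteq> power_limit G"
    using bracket_power_incl GB Lc unfolding power_limit_def by blast
  moreover have "special_frobenius_closure R \<mm> p M N \<subseteq> power_limit G"
    unfolding special_frobenius_closure_eq_limit by (rule power_limit_mono[OF GJ])
  ultimately have "L <+>\<^bsub>M\<^esub> special_frobenius_closure R \<mm> p M N \<subseteq> power_limit G"
    using submoduleE(5)[OF power_limit_is_submodule[OF G]] by (auto simp: set_add_def' subset_iff)
  then have ev: "\<B> e (L <+>\<^bsub>M\<^esub> special_frobenius_closure R \<mm> p M N) \<subseteq> eventual_submodule G e" for e
    by (rule bracket_power_subset_eventual[OF G])
  \<comment> \<open>By hypothesis some power of each element of \<open>N\<close> lies in a bracket
    power of that sum, hence is eventually mapped into \<open>G\<close>.\<close>
  have NG: "N \<subseteq> power_limit G"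
    using sub ev power_limit_iff_eventual[OF G] unfolding frobenius_closure_def by blast
  obtain S where S: "finite S" "S \<subseteq> carrier M" "generated_submodule R M S = carrier M"
    using fg unfolding finitely_generated_module_def by blast
  obtain T where T: "finite T" "T \<subseteq> N" "generated_submodule R M T = N"
    using submodule_finitely_generated[OF noeth S(1,2) N] S(3) Nc by auto
  have "\<forall>t\<in>T. \<exists>e. \<p> e t \<in> G e" using T(2) NG unfolding power_limit_def by blast
  then obtain f where f: "\<And>t. t \<in> T \<Longrightarrow> \<p> (f t) t \<in> G (f t)" by metis
  \<comment> \<open>A common bound for the witnessing exponents exists because \<open>T\<close> is
    finite; stability of \<open>G\<close> raises every generator to it.\<close>
  obtain e where e: "\<And>t. t \<in> T \<Longrightarrow> f t \<le> e"
    using finite_nat_set_iff_bounded_le[of "f ` T"] T(1) by auto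
  have TG: "\<p> e ` T \<subseteq> G e"
    using frobenius_power_mem_mono[OF G f _ e] T(2) Nc by blast
  have Tc: "\<p> e ` T \<subseteq> carrier (\<F> e)" using frobenius_power_closed T(2) Nc by blast
  \<comment> \<open>Nakayama's lemma needs a finite generating set of the bracket power. The
    elements whose q-th power lies in \<open>?H\<close> form a submodule containing
    \<open>T\<close>, hence all of \<open>N\<close>.\<close>
  have BN: "\<B> e N = generated_submodule R (\<F> e) (\<p> e ` T)"
  proof
    let ?H = "generated_submodule R (\<F> e) (\<p> e ` T)"
    have H: "submodule ?H R (\<F> e)"
      by (rule module.generated_submodule_is_submodule[OF frobenius_module_is_module Tc])
    have "N \<subseteq> {x \<in> carrier M. \<p> e x \<in> ?H}"
      unfolding T(3)[symmetric]
      by (rule generated_submodule_minimal[OF submodule_frobenius_power_preimage[OF H]])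
        (use T(2) Nc generated_submodule_incl[of "\<p> e ` T" R "\<F> e"] in blast)
    then show "\<B> e N \<subseteq> ?H"
      unfolding bracket_power_def by (intro generated_submodule_minimal[OF H]) blast
    show "?H \<subseteq> \<B> e N"
      unfolding bracket_power_def using T(2) by (intro generated_submodule_mono image_mono)
  qed
  \<comment> \<open>Nakayama's lemma is applied inside \<open>\<F> e\<close> with
    \<open>\<B> e L\<close> as \<open>K\<close>: by \<open>BN\<close>, \<open>TG\<close> says that
    the generators lie in K plus \<open>\<mm>\<close> times their own span.\<close>
  have "\<p> e ` T \<subseteq> \<B> e L"
    by (rule module.nakayama[OF frobenius_module_is_module noeth loc _ Tc bracket_power_is_submodule[OF Lc]])
      (use T(1) TG in \<open>auto simp: G_def BN\<close>)
  then have "\<B> e N \<subseteq> \<B> e L"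
    unfolding BN by (rule generated_submodule_minimal[OF bracket_power_is_submodule[OF Lc]])
  then show ?thesis
    using bracket_power_incl[of _ N e] Nc unfolding frobenius_closure_def by blast
qed

end

theorem proposition4p2:
  fixes R :: "('a, 'c) ring_scheme" and M :: "('a, 'b, 'd) module_scheme"
    and \<mm> :: "'a set" and p :: nat
  assumes "noetherian_ring R"
    and "local_ring \<mm> R"
    and "Factorial_Ring.prime p"
    and "ring_char R = p"
    and "module R M"
    and "finitely_generated_module R M"
  shows "special_part R \<mm> M (frobenius_closure R p M) (special_frobenius_closure R \<mm> p M)"
proof -
  interpret prime_characteristic_module R M p
    using assms by (simp add: prime_characteristic_module_def prime_characteristic_module_axioms_def)
  interpret m: local_ring \<mm> R by fact
  show ?thesis
    unfolding special_part_def
    using frobenius_closure_nakayama[OF assms(1,2,6)]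
    by (simp add: special_frobenius_closure_is_submodule ideal_smult_subset_special_frobenius_closure
        special_subset_frobenius_closure special_of_frobenius_closure frobenius_closure_of_special
        m.is_ideal)
qed

end
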